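(* Let $(M_1,F_1)$ and $(M_2,F_2)$ be Finsler manifolds, let $f$ be a product function, and let $(M,F)$, $M=M_1\times M_2$, $F=\sqrt{f(F_1^2,F_2^2)}$, be their Minkowskian product Finsler manifold with respect to $f$. Then $(M,F)$ is a weakly Berwald manifold if and only if $(M_1,F_1)$ and $(M_2,F_2)$ are both weakly Berwald manifolds.
   Context: A Finsler metric on a manifold $N$ is a function $F:TN\to[0,\infty)$ such that: $G=F^2$ is smooth on $TN\setminus\{0\}$; $F>0$ off the zero section; $F(x,\lambda y)=|\lambda|F(x,y)$ for all $\lambda\in\mathbb{R}$; and the Hessian $(G_{\alpha\beta})=\left(\frac{\partial^2G}{\partial y^\alpha\partial y^\beta}\right)$ (no factor $\frac12$) is positive definite off the zero section. $(G^{\alpha\beta})$ denotes the inverse matrix of $(G_{\alpha\beta})$. A product function is a continuous $f:[0,\infty)\times[0,\infty)\to[0,\infty)$ with: (a) $f(s,t)=0$ iff $(s,t)=(0,0)$; (b) $f(\lambda s,\lambda t)=\lambda f(s,t)$ for $\lambda\ge 0$; (c) $f$ is smooth on $(0,\infty)^2$; (d) $\frac{\partial f}{\partial s}\ne0$ and $\frac{\partial f}{\partial t}\neq0$ on $(0,\infty)^2$; (e) $\frac{\partial f}{\partial s}\frac{\partial f}{\partial t}-2f\frac{\partial^2f}{\partial s\partial t}\ne0$ on $(0,\infty)^2$. Given Finsler manifolds $(M_1,F_1)$, $(M_2,F_2)$ of dimensions $m$, $n$, put $K=F_1^2$, $H=F_2^2$. The Minkowskian product Finsler manifold with respect to $f$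 is $M=M_1\times M_2$ with $F=\sqrt{f(K,H)}$ on $TM\cong TM_1\oplus TM_2$; write $G=F^2=f(K,H)$. Since $f$ is smooth only on the open quadrant, all geometric objects of $F$ are considered at points $(x,y)\in TM$ whose $TM_1$- and $TM_2$-components are both nonzero (i.e. $K\ne0$, $H\ne0$); $(G_{\alpha\beta})$ is invertible there. For a Finsler metric (or for the product $F$) with $G=F^2$, in induced local coordinates $(x^\alpha,y^\alpha)$ on the tangent bundle, set $\mathbb{G}^\alpha=\frac12G^{\alpha\beta}\left(\frac{\partial^2G}{\partial y^\beta\partial x^\gamma}y^\gamma-\frac{\partial G}{\partial x^\beta}\right)$ (summation convention). The Berwald curvature is $B^\alpha_{\beta\gamma\eta}=\frac{\partial^3\mathbb{G}^\alpha}{\partial y^\beta\partial y^\gamma\partial y^\eta}$ and the mean Berwald curvature is $E_{\beta\gamma}=\frac12B^\alpha_{\beta\gamma\alpha}$. The manifold is weakly Berwald if $E_{\beta\gamma}\equiv0$. *)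

theory Defs
  imports "HOL-Analysis.Analysis"
begin

section \<open>Partial derivatives and smooth maps\<close>

text \<open>The derivative of \<open>f\<close> at \<open>z\<close> in direction \<open>v\<close>; partial derivatives are the directional
  derivatives along coordinate vectors.\<close>

definition dird :: "'a::real_normed_vector \<Rightarrow> ('a \<Rightarrow> 'b::real_normed_vector) \<Rightarrow> 'a \<Rightarrow> 'b"
  where "dird v f z = frechet_derivative f (at z) v"

text \<open>Intended for open \<open>S\<close>.\<close>

fun Ck_on :: "nat \<Rightarrow> 'a::real_normed_vector set \<Rightarrow> ('a \<Rightarrow> 'b::real_normed_vector) \<Rightarrow> bool"
  where
    "Ck_on 0 S f \<longleftrightarrow> continuous_on S f"
  | "Ck_on (Suc k) S f \<longleftrightarrow> (\<forall>z\<in>S. f differentiable (at z)) \<and> (\<forall>v. Ck_on k S (dird v f))"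

definition smooth_on :: "'a::real_normed_vector set \<Rightarrow> ('a \<Rightarrow> 'b::real_normed_vector) \<Rightarrow> bool"
  where "smooth_on S f \<longleftrightarrow> (\<forall>k. Ck_on k S f)"


section \<open>Smooth manifolds\<close>

text \<open>A chart is a domain together with a coordinate map; the values of the coordinate map outside
  the domain are irrelevant.\<close>

type_synonym ('a, 'n) chart = "'a set \<times> ('a \<Rightarrow> real ^ 'n)"

abbreviation cdom :: "('a, 'n::finite) chart \<Rightarrow> 'a set"
  where "cdom c \<equiv> fst c"

abbreviation cmap :: "('a, 'n::finite) chart \<Rightarrow> 'a \<Rightarrow> real ^ 'n"
  where "cmap c \<equiv> snd c"

definition crange :: "('a, 'n::finite) chart \<Rightarrow> (real ^ 'n) set"
  where "crange c = cmap c ` cdom c"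

definition cinv :: "('a, 'n::finite) chart \<Rightarrow> real ^ 'n \<Rightarrow> 'a"
  where "cinv c = inv_into (cdom c) (cmap c)"

definition chart_on :: "'a topology \<Rightarrow> ('a, 'n::finite) chart \<Rightarrow> bool"
  where "chart_on X c \<longleftrightarrow> openin X (cdom c) \<and> open (crange c) \<and>
    homeomorphic_map (subtopology X (cdom c)) (top_of_set (crange c)) (cmap c)"

definition compatible :: "('a, 'n::finite) chart \<Rightarrow> ('a, 'n) chart \<Rightarrow> bool"
  where "compatible c d \<longleftrightarrow>
    smooth_on (cmap c ` (cdom c \<inter> cdom d)) (cmap d \<circ> cinv c) \<and>
    smooth_on (cmap d ` (cdom c \<inter> cdom d)) (cmap c \<circ> cinv d)"

text \<open>If \<open>A\<close> is an atlas of \<open>X\<close>, this is the maximal atlas containing it.\<close>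

definition smooth_structure :: "'a topology \<Rightarrow> ('a, 'n::finite) chart set \<Rightarrow> ('a, 'n) chart set"
  where "smooth_structure X A = {c. chart_on X c \<and> (\<forall>d\<in>A. compatible c d)}"

text \<open>A nonempty smooth manifold of dimension \<open>CARD('n)\<close>. The equation \<open>smooth_structure X A = A\<close>
  says that the members of \<open>A\<close> are pairwise compatible charts and that \<open>A\<close> is maximal.\<close>

definition smooth_manifold :: "'a topology \<Rightarrow> ('a, 'n::finite) chart set \<Rightarrow> bool"
  where "smooth_manifold X A \<longleftrightarrow> topspace X \<noteq> {} \<and> Hausdorff_space X \<and> second_countable X \<and>
    topspace X = (\<Union>c\<in>A. cdom c) \<and> smooth_structure X A = A"

definition vjoin :: "(real ^ 'm::finite) \<Rightarrow> (real ^ 'n::finite) \<Rightarrow> real ^ ('m + 'n)"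
  where "vjoin u v = (\<chi> i. case i of Inl j \<Rightarrow> u $ j | Inr k \<Rightarrow> v $ k)"

definition prod_chart :: "('a, 'm::finite) chart \<Rightarrow> ('b, 'n::finite) chart \<Rightarrow> ('a \<times> 'b, 'm + 'n) chart"
  where "prod_chart c d = (cdom c \<times> cdom d, \<lambda>(p, q). vjoin (cmap c p) (cmap d q))"

definition prod_structure ::
  "'a topology \<Rightarrow> ('a, 'm::finite) chart set \<Rightarrow> 'b topology \<Rightarrow> ('b, 'n::finite) chart set
    \<Rightarrow> ('a \<times> 'b, 'm + 'n) chart set"
  where "prod_structure X A Y B =
    smooth_structure (prod_topology X Y) {prod_chart a b | a b. a \<in> A \<and> b \<in> B}"


section \<open>Tangent bundle\<close>

text \<open>A tangent vector at \<open>p\<close> is a pair \<open>(p, V)\<close>, where \<open>V\<close> assigns to each chart around \<open>p\<close> a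
  component vector such that the components in two charts are related by the Jacobian of the
  coordinate change. \<open>V\<close> is set to zero on charts that do not contain \<open>p\<close>.\<close>

type_synonym ('a, 'n) tvec = "'a \<times> (('a, 'n) chart \<Rightarrow> real ^ 'n)"

definition charts_at :: "('a, 'n::finite) chart set \<Rightarrow> 'a \<Rightarrow> ('a, 'n) chart set"
  where "charts_at A p = {c \<in> A. p \<in> cdom c}"

definition tangent_bundle :: "'a topology \<Rightarrow> ('a, 'n::finite) chart set \<Rightarrow> ('a, 'n) tvec set"
  where "tangent_bundle X A = {(p, V). p \<in> topspace X \<and>
    (\<forall>c. c \<notin> charts_at A p \<longrightarrow> V c = 0) \<and>
    (\<forall>c\<in>charts_at A p. \<forall>d\<in>charts_at A p. V d = dird (V c) (cmap d \<circ> cinv c) (cmap c p))}"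

definition tzero :: "('a, 'n::finite) tvec \<Rightarrow> bool"
  where "tzero W \<longleftrightarrow> snd W = (\<lambda>c. 0)"

definition tscale :: "real \<Rightarrow> ('a, 'n::finite) tvec \<Rightarrow> ('a, 'n) tvec"
  where "tscale r W = (fst W, \<lambda>c. r *\<^sub>R snd W c)"

definition slit_tangent_bundle :: "'a topology \<Rightarrow> ('a, 'n::finite) chart set \<Rightarrow> ('a, 'n) tvec set"
  where "slit_tangent_bundle X A = {W \<in> tangent_bundle X A. \<not> tzero W}"

text \<open>The tangent vector with induced coordinates \<open>(x, y)\<close> with respect to the chart \<open>c\<close>.\<close>

definition tvec_of :: "('a, 'n::finite) chart set \<Rightarrow> ('a, 'n) chart \<Rightarrow> (real ^ 'n) \<times> (real ^ 'n)
    \<Rightarrow> ('a, 'n) tvec"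
  where "tvec_of A c = (\<lambda>(x, y). (cinv c x,
    \<lambda>d. if d \<in> charts_at A (cinv c x) then dird y (cmap d \<circ> cinv c) x else 0))"

text \<open>The differential of \<open>h\<close>. For smooth \<open>h\<close> its value does not depend on the chart \<open>c\<close> chosen.\<close>

definition tmap :: "('a, 'm::finite) chart set \<Rightarrow> ('b, 'n::finite) chart set \<Rightarrow> ('a \<Rightarrow> 'b)
    \<Rightarrow> ('a, 'm) tvec \<Rightarrow> ('b, 'n) tvec"
  where "tmap A B h = (\<lambda>(p, V). (h p,
    \<lambda>d. if d \<in> charts_at B (h p)
        then let c = (SOME c. c \<in> charts_at A p) in dird (V c) (cmap d \<circ> h \<circ> cinv c) (cmap c p)
        else 0))"


section \<open>Finsler metrics\<close>

text \<open>The function \<open>G = F\<^sup>2\<close> in the induced coordinates \<open>(x, y)\<close> of a chart.\<close>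

definition energy :: "('a, 'n::finite) chart set \<Rightarrow> (('a, 'n) tvec \<Rightarrow> real) \<Rightarrow> ('a, 'n) chart
    \<Rightarrow> (real ^ 'n) \<times> (real ^ 'n) \<Rightarrow> real"
  where "energy A F c = (\<lambda>z. (F (tvec_of A c z))\<^sup>2)"

definition pdx :: "'n::finite \<Rightarrow> ((real ^ 'n) \<times> (real ^ 'n) \<Rightarrow> real) \<Rightarrow> (real ^ 'n) \<times> (real ^ 'n) \<Rightarrow> real"
  where "pdx a g = dird (axis a 1, 0) g"

definition pdy :: "'n::finite \<Rightarrow> ((real ^ 'n) \<times> (real ^ 'n) \<Rightarrow> real) \<Rightarrow> (real ^ 'n) \<times> (real ^ 'n) \<Rightarrow> real"
  where "pdy a g = dird (0, axis a 1) g"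

definition hess :: "((real ^ 'n::finite) \<times> (real ^ 'n) \<Rightarrow> real) \<Rightarrow> (real ^ 'n) \<times> (real ^ 'n)
    \<Rightarrow> real ^ 'n ^ 'n"
  where "hess G z = (\<chi> a b. pdy a (pdy b G) z)"

definition finsler_metric :: "'a topology \<Rightarrow> ('a, 'n::finite) chart set \<Rightarrow> (('a, 'n) tvec \<Rightarrow> real)
    \<Rightarrow> bool"
  where "finsler_metric X A F \<longleftrightarrow>
    (\<forall>W\<in>tangent_bundle X A. 0 \<le> F W) \<and>
    (\<forall>c\<in>A. smooth_on (crange c \<times> (- {0})) (energy A F c)) \<and>
    (\<forall>W\<in>slit_tangent_bundle X A. 0 < F W) \<and>
    (\<forall>W\<in>tangent_bundle X A. \<forall>r. F (tscale r W) = \<bar>r\<bar> * F W) \<and>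
    (\<forall>c\<in>A. \<forall>x\<in>crange c. \<forall>y. y \<noteq> 0 \<longrightarrow>
      (\<forall>v. v \<noteq> 0 \<longrightarrow> 0 < v \<bullet> (hess (energy A F c) (x, y) *v v)))"

definition spray_coeff :: "((real ^ 'n::finite) \<times> (real ^ 'n) \<Rightarrow> real) \<Rightarrow> 'n
    \<Rightarrow> (real ^ 'n) \<times> (real ^ 'n) \<Rightarrow> real"
  where "spray_coeff G a z =
    (1/2) * (\<Sum>b\<in>UNIV. matrix_inv (hess G z) $ a $ b *
      ((\<Sum>g\<in>UNIV. pdy b (pdx g G) z * snd z $ g) - pdx b G z))"

definition berwald :: "((real ^ 'n::finite) \<times> (real ^ 'n) \<Rightarrow> real) \<Rightarrow> 'n \<Rightarrow> 'n \<Rightarrow> 'n \<Rightarrow> 'n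
    \<Rightarrow> (real ^ 'n) \<times> (real ^ 'n) \<Rightarrow> real"
  where "berwald G a b g e = pdy b (pdy g (pdy e (spray_coeff G a)))"

definition mean_berwald :: "((real ^ 'n::finite) \<times> (real ^ 'n) \<Rightarrow> real) \<Rightarrow> 'n \<Rightarrow> 'n
    \<Rightarrow> (real ^ 'n) \<times> (real ^ 'n) \<Rightarrow> real"
  where "mean_berwald G b g z = (1/2) * (\<Sum>a\<in>UNIV. berwald G a b g a z)"

text \<open>The mean Berwald curvature vanishes in the induced coordinates of every chart, at all tangent
  vectors belonging to \<open>D\<close>, the part of the tangent bundle on which the curvature is considered.\<close>

definition weakly_berwald_on :: "('a, 'n::finite) tvec set \<Rightarrow> ('a, 'n) chart set
    \<Rightarrow> (('a, 'n) tvec \<Rightarrow> real) \<Rightarrow> bool"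
  where "weakly_berwald_on D A F \<longleftrightarrow>
    (\<forall>c\<in>A. \<forall>x\<in>crange c. \<forall>y. tvec_of A c (x, y) \<in> D \<longrightarrow>
      (\<forall>b g. mean_berwald (energy A F c) b g (x, y) = 0))"

definition weakly_berwald :: "'a topology \<Rightarrow> ('a, 'n::finite) chart set
    \<Rightarrow> (('a, 'n) tvec \<Rightarrow> real) \<Rightarrow> bool"
  where "weakly_berwald X A F \<longleftrightarrow> weakly_berwald_on (slit_tangent_bundle X A) A F"


section \<open>Minkowskian products\<close>

definition product_function :: "(real \<times> real \<Rightarrow> real) \<Rightarrow> bool"
  where "product_function f \<longleftrightarrow>
    continuous_on ({0..} \<times> {0..}) f \<and>
    (\<forall>s\<ge>0. \<forall>t\<ge>0. 0 \<le> f (s, t)) \<and>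
    (\<forall>s\<ge>0. \<forall>t\<ge>0. f (s, t) = 0 \<longleftrightarrow> s = 0 \<and> t = 0) \<and>
    (\<forall>r\<ge>0. \<forall>s\<ge>0. \<forall>t\<ge>0. f (r * s, r * t) = r * f (s, t)) \<and>
    smooth_on ({0<..} \<times> {0<..}) f \<and>
    (\<forall>z\<in>{0<..} \<times> {0<..}. dird (1, 0) f z \<noteq> 0 \<and> dird (0, 1) f z \<noteq> 0) \<and>
    (\<forall>z\<in>{0<..} \<times> {0<..}.
      dird (1, 0) f z * dird (0, 1) f z - 2 * f z * dird (1, 0) (dird (0, 1) f) z \<noteq> 0)"

text \<open>The isomorphism of \<open>T(M\<^sub>1 \<times> M\<^sub>2)\<close> with the direct sum of \<open>TM\<^sub>1\<close> and \<open>TM\<^sub>2\<close> is given by the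
  differentials of the two projections.\<close>

definition mink_product ::
  "(real \<times> real \<Rightarrow> real) \<Rightarrow>
    'a topology \<Rightarrow> ('a, 'm::finite) chart set \<Rightarrow> (('a, 'm) tvec \<Rightarrow> real) \<Rightarrow>
    'b topology \<Rightarrow> ('b, 'n::finite) chart set \<Rightarrow> (('b, 'n) tvec \<Rightarrow> real) \<Rightarrow>
    ('a \<times> 'b, 'm + 'n) tvec \<Rightarrow> real"
  where "mink_product f X1 A1 F1 X2 A2 F2 W =
    (let A = prod_structure X1 A1 X2 A2
     in sqrt (f ((F1 (tmap A A1 fst W))\<^sup>2, (F2 (tmap A A2 snd W))\<^sup>2)))"

text \<open>The tangent vectors of the product both of whose components are nonzero.\<close>

definition regular_part ::
  "'a topology \<Rightarrow> ('a, 'm::finite) chart set \<Rightarrow> 'b topology \<Rightarrow> ('b, 'n::finite) chart set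
    \<Rightarrow> ('a \<times> 'b, 'm + 'n) tvec set"
  where "regular_part X1 A1 X2 A2 =
    (let A = prod_structure X1 A1 X2 A2
     in {W \<in> tangent_bundle (prod_topology X1 X2) A.
          \<not> tzero (tmap A A1 fst W) \<and> \<not> tzero (tmap A A2 snd W)})"

text \<open>As \<open>f\<close> need not be smooth on the boundary of the quadrant, the curvature of the product is
  considered on the regular part only.\<close>

definition product_weakly_berwald ::
  "(real \<times> real \<Rightarrow> real) \<Rightarrow>
    'a topology \<Rightarrow> ('a, 'm::finite) chart set \<Rightarrow> (('a, 'm) tvec \<Rightarrow> real) \<Rightarrow>
    'b topology \<Rightarrow> ('b, 'n::finite) chart set \<Rightarrow> (('b, 'n) tvec \<Rightarrow> real) \<Rightarrow> bool"
  where "product_weakly_berwald f X1 A1 F1 X2 A2 F2 \<longleftrightarrow>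
    weakly_berwald_on (regular_part X1 A1 X2 A2) (prod_structure X1 A1 X2 A2)
      (mink_product f X1 A1 F1 X2 A2 F2)"

end

theory Submission
  imports Defs
begin

text \<open>
  The mean Berwald curvature is, up to the factor \<open>1/2\<close>, the fibre Hessian of the vertical divergence
  \<open>\<partial>G\<^sup>a/\<partial>y\<^sup>a\<close> of the spray coefficients (\<open>mean_berwald_zero_iff\<close>). The theorem holds because the spray of
  a Minkowskian product is the product of the sprays of its factors, whatever the product function
  \<open>f\<close> is.

  The spray is characterized by the geodesic equation \<open>S (\<partial>G/\<partial>y) = \<partial>G/\<partial>x\<close> for
  \<open>S = y \<partial>\<^sub>x - 2 q \<partial>\<^sub>y\<close>, which has at most one solution \<open>q\<close> where the fibre Hessian of \<open>G\<close> is nondegenerate.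
  Let \<open>K\<close> and \<open>H\<close> be the squares of the two Finsler metrics. By homogeneity a spray annihilates its
  own energy (\<open>energy_conserved\<close>), so the product of the two sprays annihilates \<open>K\<close>, \<open>H\<close> and hence the
  partial derivatives of \<open>f\<close> at \<open>(K, H)\<close>. The geodesic equation of \<open>f(K, H)\<close> then follows from those of
  \<open>K\<close> and \<open>H\<close> (\<open>geodesic_eq_product\<close>). Nondegeneracy of \<open>f(K, H)\<close> reduces to a determinant of size two,
  which is the expression required to be nonzero in the definition of a product function
  (\<open>nondeg_G\<close>). The vertical divergence of a product of sprays is the sum of the divergences, each of which
  depends on one factor only, and its fibre Hessian vanishes precisely if both fibre Hessians do
  (\<open>fibre_affine_product\<close>).

  The charts of the product manifold include many that are not product charts, and the curvature has to
  be examined in all of them. Under a coordinate change the spray acquires a term that is quadratic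
  in \<open>y\<close>, so the vertical divergence changes by a term linear in \<open>y\<close>, which the second fibre derivatives
  kill (\<open>fibre_affine_transform\<close>). In order to treat arbitrary charts and the splitting together,
  sprays are handled in arbitrary Euclidean spaces: the coordinate change leads directly from a
  chart with values in \<open>real ^ ('m + 'n)\<close> to pairs of coordinate vectors of the factors.
\<close>

section \<open>Directional derivatives\<close>

lemma dird_eqI:
  assumes "(f has_derivative D) (at z)"
  shows "dird v f z = D v"
  using frechet_derivative_at[OF assms] by (simp add: dird_def)

lemma has_derivative_dird:
  assumes "f differentiable (at z)"
  shows "(f has_derivative (\<lambda>v. dird v f z)) (at z)"
  using assms by (simp add: dird_def frechet_derivative_works[symmetric])

lemma linear_dird:
  assumes "f differentiable (at z)"
  shows "linear (\<lambda>v. dird v f z)"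
  using has_derivative_linear[OF has_derivative_dird[OF assms]] .

lemmas dird_add_dir = linear_add[OF linear_dird]
  and dird_scaleR_dir = linear_cmul[OF linear_dird]
  and dird_zero_dir = linear_0[OF linear_dird]

lemma dird_basis_expand:
  fixes f :: "'a::euclidean_space \<Rightarrow> 'b::real_normed_vector"
  assumes "f differentiable (at z)"
  shows "dird v f z = (\<Sum>b\<in>Basis. (v \<bullet> b) *\<^sub>R dird b f z)"
proof -
  have "dird v f z = dird (\<Sum>b\<in>Basis. (v \<bullet> b) *\<^sub>R b) f z"
    by (simp add: euclidean_representation)
  also have "\<dots> = (\<Sum>b\<in>Basis. dird ((v \<bullet> b) *\<^sub>R b) f z)"
    using linear_sum[OF linear_dird[OF assms], of "\<lambda>b. (v \<bullet> b) *\<^sub>R b" Basis] by simp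
  finally show ?thesis
    by (simp add: dird_scaleR_dir[OF assms])
qed

lemma dird_cong_open:
  assumes "open S" "z \<in> S" "\<And>x. x \<in> S \<Longrightarrow> f x = g x"
  shows "dird v f z = dird v g z"
proof -
  have "(f has_derivative D) (at z) \<longleftrightarrow> (g has_derivative D) (at z)" for D
    using has_derivative_transform_within_open[of f D z UNIV S g]
      has_derivative_transform_within_open[of g D z UNIV S f] assms by auto
  then show ?thesis by (simp add: dird_def frechet_derivative_def)
qed

lemma differentiable_cong_open:
  assumes "open S" "z \<in> S" "\<And>x. x \<in> S \<Longrightarrow> f x = g x" "f differentiable (at z)"
  shows "g differentiable (at z)"
  using assms has_derivative_transform_within_open[of f _ z UNIV S g]
  unfolding differentiable_def by auto

text \<open>A directional derivative only sees the restriction of the function to a line. This is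
  how identities that hold for fixed base point are differentiated in the fibre.\<close>

lemma has_vector_derivative_line:
  assumes "F differentiable (at z)"
  shows "((\<lambda>t. F (z + t *\<^sub>R u)) has_vector_derivative dird u F z) (at 0)"
proof -
  have 1: "((\<lambda>t::real. z + t *\<^sub>R u) has_derivative (\<lambda>t. t *\<^sub>R u)) (at 0)"
    by (auto intro!: derivative_eq_intros)
  have "((\<lambda>t. F (z + t *\<^sub>R u)) has_derivative (\<lambda>t. dird (t *\<^sub>R u) F z)) (at 0)"
    using has_derivative_compose[OF 1, of F "\<lambda>v. dird v F z"] has_derivative_dird[OF assms] by simp
  then show ?thesis
    by (simp add: has_vector_derivative_def dird_scaleR_dir[OF assms])
qed

lemma dird_line_cong:
  assumes "F differentiable (at z)" "H differentiable (at z')"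
    and "\<forall>\<^sub>F t in nhds (0::real). F (z + t *\<^sub>R u) = H (z' + t *\<^sub>R u')"
  shows "dird u F z = dird u' H z'"
proof -
  obtain S where S: "open S" "0 \<in> S" "\<And>t. t \<in> S \<Longrightarrow> F (z + t *\<^sub>R u) = H (z' + t *\<^sub>R u')"
    using assms(3) unfolding eventually_nhds by blast
  have "((\<lambda>t. H (z' + t *\<^sub>R u')) has_vector_derivative dird u F z) (at 0)"
    by (rule has_vector_derivative_transform_within_open
      [OF has_vector_derivative_line[OF assms(1)] S])
  then show ?thesis
    by (rule vector_derivative_unique_at[OF _ has_vector_derivative_line[OF assms(2)]])
qed

lemma dird_compose:
  assumes "f differentiable (at z)" "g differentiable (at (f z))"
  shows "dird v (\<lambda>x. g (f x)) z = dird (dird v f z) g (f z)"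
  using dird_eqI[OF has_derivative_compose[OF has_derivative_dird[OF assms(1)]
    has_derivative_dird[OF assms(2)]]] .

lemma differentiable_compose_at:
  assumes "f differentiable (at z)" "g differentiable (at (f z))"
  shows "(\<lambda>x. g (f x)) differentiable (at z)"
  using differentiable_chain_at[OF assms] by (simp add: o_def)

lemma dird_bounded_linear: "bounded_linear f \<Longrightarrow> dird v f z = f v"
  by (simp add: dird_eqI bounded_linear_imp_has_derivative)

lemma dird_const [simp]: "dird v (\<lambda>x. c) z = 0"
  by (simp add: dird_eqI[OF has_derivative_const])

lemma dird_bilinear:
  assumes "bounded_bilinear h" "f differentiable (at z)" "g differentiable (at z)"
  shows "dird v (\<lambda>x. h (f x) (g x)) z = h (f z) (dird v g z) + h (dird v f z) (g z)"
  by (rule dird_eqI[OF bounded_bilinear.FDERIV[OF assms(1)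
    has_derivative_dird[OF assms(2)] has_derivative_dird[OF assms(3)]]])

lemma differentiable_bilinear:
  assumes "bounded_bilinear h" "f differentiable (at z)" "g differentiable (at z)"
  shows "(\<lambda>x. h (f x) (g x)) differentiable (at z)"
  using bounded_bilinear.FDERIV[OF assms(1)
    has_derivative_dird[OF assms(2)] has_derivative_dird[OF assms(3)]]
  unfolding differentiable_def by blast

lemma dird_linear_fun:
  assumes "bounded_linear h" "f differentiable (at z)"
  shows "dird v (\<lambda>x. h (f x)) z = h (dird v f z)"
  by (rule dird_eqI[OF bounded_linear.has_derivative[OF assms(1) has_derivative_dird[OF assms(2)]]])

lemma differentiable_linear_fun:
  assumes "bounded_linear h" "f differentiable (at z)"
  shows "(\<lambda>x. h (f x)) differentiable (at z)"
  using bounded_linear.has_derivative[OF assms(1) has_derivative_dird[OF assms(2)]]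
  unfolding differentiable_def by blast

lemma dird_add:
  assumes "f differentiable (at z)" "g differentiable (at z)"
  shows "dird v (\<lambda>x. f x + g x) z = dird v f z + dird v g z"
  by (rule dird_eqI[OF has_derivative_add[OF has_derivative_dird[OF assms(1)]
    has_derivative_dird[OF assms(2)]]])

lemma dird_Pair:
  assumes "f differentiable (at z)" "g differentiable (at z)"
  shows "dird v (\<lambda>x. (f x, g x)) z = (dird v f z, dird v g z)"
  by (rule dird_eqI[OF has_derivative_Pair[OF has_derivative_dird[OF assms(1)]
    has_derivative_dird[OF assms(2)]]])

lemma differentiable_Pair:
  assumes "f differentiable (at z)" "g differentiable (at z)"
  shows "(\<lambda>x. (f x, g x)) differentiable (at z)"
  using has_derivative_Pair[OF has_derivative_dird[OF assms(1)] has_derivative_dird[OF assms(2)]]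
  unfolding differentiable_def by blast

lemma dird_sum:
  assumes "\<And>i. i \<in> I \<Longrightarrow> f i differentiable (at z)"
  shows "dird v (\<lambda>x. \<Sum>i\<in>I. f i x) z = (\<Sum>i\<in>I. dird v (f i) z)"
  using dird_eqI[OF has_derivative_sum, of I f "\<lambda>i v. dird v (f i) z" z v]
    has_derivative_dird assms by blast

section \<open>Smooth maps\<close>

lemma Ck_on_cong:
  assumes "open S" "\<And>x. x \<in> S \<Longrightarrow> f x = g x" "Ck_on k S f"
  shows "Ck_on k S g"
  using assms(2,3)
proof (induction k arbitrary: f g)
  case 0
  then show ?case by (simp cong: continuous_on_cong)
next
  case (Suc k)
  have "Ck_on k S (dird v g)" for v
    by (rule Suc.IH[of "dird v f"]) (use Suc.prems in \<open>auto intro: dird_cong_open[OF assms(1)]\<close>)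
  then show ?case
    using Suc.prems differentiable_cong_open[OF assms(1), of _ f g] by auto
qed

lemma Ck_on_SucD: "Ck_on (Suc k) S f \<Longrightarrow> Ck_on k S f"
proof (induction k arbitrary: f)
  case 0
  then show ?case
    by (auto intro!: continuous_at_imp_continuous_on differentiable_imp_continuous_within)
next
  case (Suc k)
  then show ?case by (metis Ck_on.simps(2))
qed

lemma Ck_on_subset: "Ck_on k S f \<Longrightarrow> T \<subseteq> S \<Longrightarrow> Ck_on k T f"
  by (induction k arbitrary: f) (auto intro: continuous_on_subset)

lemma Ck_on_const: "Ck_on k (S :: 'a::real_normed_vector set) (\<lambda>x. c)"
proof (induction k arbitrary: c)
  case (Suc k)
  have "dird v (\<lambda>x::'a. c) = (\<lambda>x. 0)" for v by auto
  then show ?case using Suc by auto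
qed auto

lemma Ck_on_bounded_linear: "bounded_linear f \<Longrightarrow> Ck_on k S f"
proof (cases k)
  case 0
  then show "bounded_linear f \<Longrightarrow> ?thesis" by (simp add: linear_continuous_on)
next
  case (Suc j)
  assume f: "bounded_linear f"
  have "dird v f = (\<lambda>x. f v)" for v
    using dird_bounded_linear[OF f] by auto
  then show ?thesis
    using Suc f by (auto simp: Ck_on_const bounded_linear_imp_differentiable)
qed

lemma Ck_on_add:
  assumes S: "open S"
  shows "Ck_on k S f \<Longrightarrow> Ck_on k S g \<Longrightarrow> Ck_on k S (\<lambda>x. f x + g x)"
proof (induction k arbitrary: f g)
  case 0
  then show ?case by (simp add: continuous_on_add)
next
  case (Suc k)
  have "Ck_on k S (dird v (\<lambda>x. f x + g x))" for v
    by (rule Ck_on_cong[OF S _ Suc.IH[of "dird v f" "dird v g"]])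
      (use Suc.prems in \<open>auto simp: dird_add\<close>)
  then show ?case using Suc.prems by auto
qed

lemma Ck_on_bilinear:
  assumes h: "bounded_bilinear h" and S: "open S"
  shows "Ck_on k S f \<Longrightarrow> Ck_on k S g \<Longrightarrow> Ck_on k S (\<lambda>x. h (f x) (g x))"
proof (induction k arbitrary: f g)
  case 0
  then show ?case by (simp add: bounded_bilinear.continuous_on[OF h])
next
  case (Suc k)
  note lower = Suc.prems[THEN Ck_on_SucD]
  have "Ck_on k S (dird v (\<lambda>x. h (f x) (g x)))" for v
    by (rule Ck_on_cong[OF S _ Ck_on_add[OF S Suc.IH[of f "dird v g"] Suc.IH[of "dird v f" g]]])
      (use Suc.prems lower in \<open>auto simp: dird_bilinear[OF h]\<close>)
  then show ?case using Suc.prems by (auto intro: differentiable_bilinear[OF h])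
qed

lemma Ck_on_sum:
  assumes S: "open S"
  shows "(\<And>i. i \<in> I \<Longrightarrow> Ck_on k S (f i)) \<Longrightarrow> Ck_on k S (\<lambda>x. \<Sum>i\<in>I. f i x)"
  by (induction I rule: infinite_finite_induct) (auto simp: Ck_on_const intro: Ck_on_add[OF S])

lemma Ck_on_linear_fun:
  assumes h: "bounded_linear h"
  shows "open S \<Longrightarrow> Ck_on k S f \<Longrightarrow> Ck_on k S (\<lambda>x. h (f x))"
proof (induction k arbitrary: f)
  case 0
  then show ?case by (simp add: bounded_linear.continuous_on[OF h])
next
  case (Suc k)
  have "Ck_on k S (dird v (\<lambda>x. h (f x)))" for v
    by (rule Ck_on_cong[OF Suc.prems(1) _ Suc.IH[of "dird v f"]])
      (use Suc.prems in \<open>auto simp: dird_linear_fun[OF h]\<close>)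
  then show ?case using Suc.prems by (auto intro: differentiable_linear_fun[OF h])
qed

lemma Ck_on_compose:
  fixes f :: "'a::real_normed_vector \<Rightarrow> 'b::euclidean_space"
    and g :: "'b \<Rightarrow> 'c::real_normed_vector"
  assumes S: "open S" and T: "open T" and fST: "\<And>x. x \<in> S \<Longrightarrow> f x \<in> T"
  shows "Ck_on k S f \<Longrightarrow> Ck_on k T g \<Longrightarrow> Ck_on k S (\<lambda>x. g (f x))"
proof (induction k arbitrary: g)
  case 0
  then have "continuous_on S (g \<circ> f)"
    using fST by (intro continuous_on_compose) (auto intro: continuous_on_subset)
  then show ?case by (simp add: o_def)
next
  case (Suc k)
  have df: "\<And>x. x \<in> S \<Longrightarrow> f differentiable (at x)" and dg: "\<And>y. y \<in> T \<Longrightarrow> g differentiable (at y)"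
    using Suc.prems by auto
  have "Ck_on k S (dird v (\<lambda>x. g (f x)))" for v
  proof (rule Ck_on_cong[OF S])
    show "Ck_on k S (\<lambda>x. \<Sum>b\<in>Basis. (dird v f x \<bullet> b) *\<^sub>R dird b g (f x))"
    proof (rule Ck_on_sum[OF S], rule Ck_on_bilinear[OF bounded_bilinear_scaleR S])
      fix b :: 'b
      show "Ck_on k S (\<lambda>x. dird v f x \<bullet> b)"
        using Suc.prems(1) by (intro Ck_on_linear_fun[OF bounded_linear_inner_left S]) simp
      show "Ck_on k S (\<lambda>x. dird b g (f x))"
        using Suc.prems(2) by (intro Suc.IH[of "dird b g"] Ck_on_SucD[OF Suc.prems(1)]) simp
    qed
    show "(\<Sum>b\<in>Basis. (dird v f x \<bullet> b) *\<^sub>R dird b g (f x)) = dird v (\<lambda>x. g (f x)) x" if "x \<in> S" for x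
      using dird_compose[OF df[OF that] dg[OF fST[OF that]]]
        dird_basis_expand[OF dg[OF fST[OF that]], of "dird v f x"] by simp
  qed
  then show ?case
    using differentiable_compose_at[OF df dg] fST by auto
qed

text \<open>The derivative of \<open>1/f\<close> is a product of \<open>1/f\<close> with itself and a derivative of \<open>f\<close>, so that the
  class of \<open>1/f\<close> can be raised one step at a time.\<close>

lemma Ck_on_inverse:
  fixes f :: "'a::real_normed_vector \<Rightarrow> real"
  assumes S: "open S" and nz: "\<And>x. x \<in> S \<Longrightarrow> f x \<noteq> 0"
  shows "Ck_on k S f \<Longrightarrow> Ck_on k S (\<lambda>x. inverse (f x))"
proof (induction k)
  case 0
  then show ?case using nz by (simp add: continuous_on_inverse)
next
  case (Suc k)
  have lower: "Ck_on k S (\<lambda>x. inverse (f x))"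
    using Suc.IH Ck_on_SucD[OF Suc.prems] by blast
  have der: "((\<lambda>x. inverse (f x)) has_derivative
      (\<lambda>v. - (inverse (f x) * dird v f x * inverse (f x)))) (at x)" if "x \<in> S" for x
    using Suc.prems that nz by (intro Deriv.has_derivative_inverse has_derivative_dird) auto
  have "Ck_on k S (dird v (\<lambda>x. inverse (f x)))" for v
  proof (rule Ck_on_cong[OF S])
    show "Ck_on k S (\<lambda>x. - (inverse (f x) * dird v f x * inverse (f x)))"
      using Suc.prems lower
      by (intro Ck_on_linear_fun[OF bounded_linear_minus[OF bounded_linear_ident] S]
        Ck_on_bilinear[OF bounded_bilinear_mult S]) auto
  qed (simp add: dird_eqI[OF der])
  then show ?case using der by (auto simp: differentiable_def)
qed

lemma smooth_on_differentiable: "smooth_on S f \<Longrightarrow> z \<in> S \<Longrightarrow> f differentiable (at z)"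
  unfolding smooth_on_def by (metis Ck_on.simps(2))

lemma smooth_on_continuous_on: "smooth_on S f \<Longrightarrow> continuous_on S f"
  unfolding smooth_on_def by (metis Ck_on.simps(1))

lemma smooth_on_dird: "smooth_on S f \<Longrightarrow> smooth_on S (dird v f)"
  unfolding smooth_on_def by (metis Ck_on.simps(2))

lemma smooth_on_cong:
  "smooth_on S f \<Longrightarrow> open S \<Longrightarrow> (\<And>x. x \<in> S \<Longrightarrow> f x = g x) \<Longrightarrow> smooth_on S g"
  unfolding smooth_on_def using Ck_on_cong by blast

lemma smooth_on_subset: "smooth_on S f \<Longrightarrow> T \<subseteq> S \<Longrightarrow> smooth_on T f"
  unfolding smooth_on_def using Ck_on_subset by blast

lemma smooth_on_const: "smooth_on S (\<lambda>x. c)"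
  by (simp add: smooth_on_def Ck_on_const)

lemma smooth_on_bounded_linear: "bounded_linear f \<Longrightarrow> smooth_on S f"
  by (simp add: smooth_on_def Ck_on_bounded_linear)

lemma smooth_on_linear_fun:
  "bounded_linear h \<Longrightarrow> open S \<Longrightarrow> smooth_on S f \<Longrightarrow> smooth_on S (\<lambda>x. h (f x))"
  by (simp add: smooth_on_def Ck_on_linear_fun)

lemma smooth_on_add:
  "open S \<Longrightarrow> smooth_on S f \<Longrightarrow> smooth_on S g \<Longrightarrow> smooth_on S (\<lambda>x. f x + g x)"
  by (simp add: smooth_on_def Ck_on_add)

lemma smooth_on_bilinear:
  "bounded_bilinear h \<Longrightarrow> open S \<Longrightarrow> smooth_on S f \<Longrightarrow> smooth_on S g
    \<Longrightarrow> smooth_on S (\<lambda>x. h (f x) (g x))"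
  by (simp add: smooth_on_def Ck_on_bilinear)

lemmas smooth_on_scaleR = smooth_on_bilinear[OF bounded_bilinear_scaleR]
  and smooth_on_mult = smooth_on_bilinear[OF bounded_bilinear_mult]

lemma smooth_on_sum:
  "open S \<Longrightarrow> (\<And>i. i \<in> I \<Longrightarrow> smooth_on S (f i)) \<Longrightarrow> smooth_on S (\<lambda>x. \<Sum>i\<in>I. f i x)"
  by (simp add: smooth_on_def Ck_on_sum)

lemma smooth_on_prod:
  fixes f :: "'i \<Rightarrow> 'a::real_normed_vector \<Rightarrow> real"
  shows "open S \<Longrightarrow> (\<And>i. i \<in> I \<Longrightarrow> smooth_on S (f i)) \<Longrightarrow> smooth_on S (\<lambda>x. \<Prod>i\<in>I. f i x)"
  by (induction I rule: infinite_finite_induct) (auto simp: smooth_on_const intro: smooth_on_mult)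

lemma smooth_on_compose:
  fixes f :: "'a::real_normed_vector \<Rightarrow> 'b::euclidean_space"
    and g :: "'b \<Rightarrow> 'c::real_normed_vector"
  shows "open S \<Longrightarrow> open T \<Longrightarrow> (\<And>x. x \<in> S \<Longrightarrow> f x \<in> T) \<Longrightarrow> smooth_on S f \<Longrightarrow> smooth_on T g
    \<Longrightarrow> smooth_on S (\<lambda>x. g (f x))"
  unfolding smooth_on_def by (blast intro: Ck_on_compose)

lemma smooth_on_divide:
  fixes f g :: "'a::real_normed_vector \<Rightarrow> real"
  shows "open S \<Longrightarrow> (\<And>x. x \<in> S \<Longrightarrow> g x \<noteq> 0) \<Longrightarrow> smooth_on S f \<Longrightarrow> smooth_on S g
    \<Longrightarrow> smooth_on S (\<lambda>x. f x / g x)"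
  unfolding divide_inverse
  by (intro smooth_on_mult) (auto simp: smooth_on_def Ck_on_inverse)

lemma smooth_on_Pair:
  assumes "open S" "smooth_on S f" "smooth_on S g"
  shows "smooth_on S (\<lambda>x. (f x, g x))"
proof -
  have "smooth_on S (\<lambda>x. (f x, 0) + (0, g x))"
    using assms by (intro smooth_on_add smooth_on_linear_fun[of "\<lambda>a. (a, 0)"]
      smooth_on_linear_fun[of "\<lambda>a. (0, a)"])
      (auto intro!: bounded_linear_Pair bounded_linear_ident bounded_linear_zero)
  then show ?thesis by simp
qed

lemma smooth_on_componentwise:
  fixes f :: "'a::real_normed_vector \<Rightarrow> 'b::euclidean_space"
  assumes "open S" "\<And>b. b \<in> Basis \<Longrightarrow> smooth_on S (\<lambda>x. f x \<bullet> b)"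
  shows "smooth_on S f"
proof -
  have "smooth_on S (\<lambda>x. \<Sum>b\<in>Basis. (f x \<bullet> b) *\<^sub>R b)"
    using assms by (intro smooth_on_sum smooth_on_scaleR smooth_on_const) auto
  then show ?thesis by (simp add: euclidean_representation)
qed

text \<open>Coordinate changes of tangent vectors differentiate a map in a direction that moves with the
  point. Expanding the direction in a basis reduces this to derivatives in fixed directions.\<close>

lemma smooth_on_dird_along:
  fixes g :: "'b::euclidean_space \<Rightarrow> 'c::real_normed_vector"
    and m h :: "'a::real_normed_vector \<Rightarrow> 'b"
  assumes "open S" "open T" "\<And>x. x \<in> S \<Longrightarrow> h x \<in> T"
    and "smooth_on S m" "smooth_on S h" "smooth_on T g"
  shows "smooth_on S (\<lambda>z. dird (m z) g (h z))"
proof (rule smooth_on_cong[OF _ assms(1)])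
  show "smooth_on S (\<lambda>z. \<Sum>b\<in>Basis. (m z \<bullet> b) *\<^sub>R dird b g (h z))"
  proof (rule smooth_on_sum[OF assms(1)], rule smooth_on_scaleR[OF assms(1)])
    fix b :: 'b
    show "smooth_on S (\<lambda>z. m z \<bullet> b)"
      by (rule smooth_on_linear_fun[OF bounded_linear_inner_left assms(1,4)])
    show "smooth_on S (\<lambda>z. dird b g (h z))"
      by (rule smooth_on_compose[OF assms(1-3) assms(5) smooth_on_dird[OF assms(6)]])
  qed
  show "\<And>z. z \<in> S \<Longrightarrow> (\<Sum>b\<in>Basis. (m z \<bullet> b) *\<^sub>R dird b g (h z)) = dird (m z) g (h z)"
    using assms by (simp add: dird_basis_expand[symmetric] smooth_on_differentiable)
qed

text \<open>The product rule for the basis expansion gives one term for the motion of the direction and one for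
  the motion of the point.\<close>

lemma dird_dird_along:
  fixes g :: "'b::euclidean_space \<Rightarrow> 'c::real_normed_vector"
    and m h :: "'a::real_normed_vector \<Rightarrow> 'b"
  assumes "open S" "open T" "\<And>x. x \<in> S \<Longrightarrow> h x \<in> T"
    and "smooth_on S m" "smooth_on S h" "smooth_on T g" and z: "z \<in> S"
  shows "dird v (\<lambda>z. dird (m z) g (h z)) z =
    dird (dird v m z) g (h z) + dird (dird v h z) (dird (m z) g) (h z)"
proof -
  note dif = smooth_on_differentiable
  have m: "m differentiable (at z)" and h: "h differentiable (at z)"
    and g: "g differentiable (at (h z))" "\<And>b. dird b g differentiable (at (h z))"
    using assms by (auto intro: dif smooth_on_dird)
  have mb: "(\<lambda>z. m z \<bullet> b) differentiable (at z)" for b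
    by (rule differentiable_linear_fun[OF bounded_linear_inner_left m])
  have gb: "(\<lambda>z. dird b g (h z)) differentiable (at z)" for b
    by (rule differentiable_compose_at[OF h g(2)])
  have "dird v (\<lambda>z. dird (m z) g (h z)) z = dird v (\<lambda>z. \<Sum>b\<in>Basis. (m z \<bullet> b) *\<^sub>R dird b g (h z)) z"
    by (rule dird_cong_open[OF assms(1) z])
      (use assms in \<open>simp add: dird_basis_expand[symmetric] smooth_on_differentiable\<close>)
  also have "\<dots> = (\<Sum>b\<in>Basis. dird v (\<lambda>z. (m z \<bullet> b) *\<^sub>R dird b g (h z)) z)"
    using mb gb by (intro dird_sum differentiable_bilinear[OF bounded_bilinear_scaleR])
  also have "\<dots> = (\<Sum>b\<in>Basis. (m z \<bullet> b) *\<^sub>R dird (dird v h z) (dird b g) (h z)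
      + (dird v m z \<bullet> b) *\<^sub>R dird b g (h z))"
    by (simp add: dird_bilinear[OF bounded_bilinear_scaleR mb gb] dird_compose[OF h g(2)]
      dird_linear_fun[OF bounded_linear_inner_left m])
  also have "\<dots> = (\<Sum>b\<in>Basis. (m z \<bullet> b) *\<^sub>R dird (dird v h z) (dird b g) (h z))
      + dird (dird v m z) g (h z)"
    by (simp add: sum.distrib dird_basis_expand[OF g(1), of "dird v m z"])
  also have "(\<Sum>b\<in>Basis. (m z \<bullet> b) *\<^sub>R dird (dird v h z) (dird b g) (h z))
      = (\<Sum>b\<in>Basis. dird (dird v h z) (\<lambda>y. (m z \<bullet> b) *\<^sub>R dird b g y) (h z))"
    by (simp add: dird_linear_fun[OF bounded_linear_scaleR_right g(2)])
  also have "\<dots> = dird (dird v h z) (\<lambda>y. \<Sum>b\<in>Basis. (m z \<bullet> b) *\<^sub>R dird b g y) (h z)"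
    by (rule dird_sum[symmetric]) (rule differentiable_linear_fun[OF bounded_linear_scaleR_right g(2)])
  also have "\<dots> = dird (dird v h z) (dird (m z) g) (h z)"
    by (rule dird_cong_open[OF assms(2)])
      (use assms in \<open>auto simp: dird_basis_expand[symmetric] smooth_on_differentiable\<close>)
  finally show ?thesis by (simp add: add.commute)
qed

section \<open>Symmetry of second derivatives\<close>

text \<open>The mean value theorem is applied once in each direction: first to the difference of \<open>f\<close> along
  two parallel sides of the parallelogram, then to the derivative \<open>dird u f\<close>. The left-hand side is
  symmetric in \<open>u\<close> and \<open>v\<close>, so both mixed derivatives take the same value somewhere near \<open>z\<close>.\<close>

lemma mixed_difference_mvt:
  fixes f :: "'a::real_normed_vector \<Rightarrow> real"
  assumes f: "\<And>x. x \<in> ball z e \<Longrightarrow> f differentiable (at x)"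
    and fu: "\<And>x. x \<in> ball z e \<Longrightarrow> dird u f differentiable (at x)"
    and h: "0 < h" "h * (norm u + norm v) < e"
  shows "\<exists>p\<in>ball z e. f (z + h *\<^sub>R u + h *\<^sub>R v) - f (z + h *\<^sub>R u) - f (z + h *\<^sub>R v) + f z
    = h * h * dird v (dird u f) p"
proof -
  have inb: "z + s *\<^sub>R u + t *\<^sub>R v \<in> ball z e" if "0 \<le> s" "s \<le> h" "0 \<le> t" "t \<le> h" for s t
  proof -
    have "norm (s *\<^sub>R u + t *\<^sub>R v) \<le> s * norm u + t * norm v"
      using that norm_triangle_ineq[of "s *\<^sub>R u" "t *\<^sub>R v"] by simp
    also have "\<dots> \<le> h * norm u + h * norm v"
      using that by (intro add_mono mult_right_mono) auto
    finally have "norm (s *\<^sub>R u + t *\<^sub>R v) < e"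
      using h(2) by (simp add: algebra_simps)
    moreover have "dist z (z + s *\<^sub>R u + t *\<^sub>R v) = norm (s *\<^sub>R u + t *\<^sub>R v)"
      by (metis dist_norm dist_commute add.assoc add_diff_cancel_left')
    ultimately show ?thesis by simp
  qed
  have line: "((\<lambda>t. g (y + t *\<^sub>R w)) has_real_derivative dird w g (y + t *\<^sub>R w)) (at t)"
    if "g differentiable (at (y + t *\<^sub>R w))" for g :: "'a \<Rightarrow> real" and y w t
  proof -
    have 1: "((\<lambda>t::real. y + t *\<^sub>R w) has_derivative (\<lambda>t. t *\<^sub>R w)) (at t)"
      by (auto intro!: derivative_eq_intros)
    have "(\<lambda>s. dird (s *\<^sub>R w) g (y + t *\<^sub>R w)) = (*) (dird w g (y + t *\<^sub>R w))"
      by (simp add: dird_scaleR_dir[OF that] fun_eq_iff)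
    then show ?thesis
      using has_derivative_compose[OF 1 has_derivative_dird[OF that]]
      by (simp add: has_field_derivative_def)
  qed
  define \<phi> where "\<phi> s = f ((z + h *\<^sub>R v) + s *\<^sub>R u) - f (z + s *\<^sub>R u)" for s
  have d\<phi>: "(\<phi> has_real_derivative
      dird u f ((z + h *\<^sub>R v) + s *\<^sub>R u) - dird u f (z + s *\<^sub>R u)) (at s)" if "0 \<le> s" "s \<le> h" for s
    unfolding \<phi>_def using inb[of s h] inb[of s 0] that h(1)
    by (intro DERIV_diff line f) (auto simp: add_ac)
  obtain s where s: "0 < s" "s < h"
    and s_eq: "\<phi> h - \<phi> 0 = (h - 0) * (dird u f ((z + h *\<^sub>R v) + s *\<^sub>R u) - dird u f (z + s *\<^sub>R u))"
    using MVT2[OF h(1), of \<phi> "\<lambda>s. dird u f ((z + h *\<^sub>R v) + s *\<^sub>R u) - dird u f (z + s *\<^sub>R u)"] d\<phi>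
    by metis
  obtain t where t: "0 < t" "t < h"
    and t_eq: "dird u f ((z + s *\<^sub>R u) + h *\<^sub>R v) - dird u f ((z + s *\<^sub>R u) + 0 *\<^sub>R v)
      = (h - 0) * dird v (dird u f) ((z + s *\<^sub>R u) + t *\<^sub>R v)"
    using MVT2[OF h(1), of "\<lambda>t. dird u f ((z + s *\<^sub>R u) + t *\<^sub>R v)"
      "\<lambda>t. dird v (dird u f) ((z + s *\<^sub>R u) + t *\<^sub>R v)"]
      line[OF fu[OF inb]] s by (metis less_imp_le)
  show ?thesis
    using inb[of s t] s t s_eq t_eq
    by (intro bexI[of _ "z + s *\<^sub>R u + t *\<^sub>R v"]) (auto simp: \<phi>_def add_ac)
qed

text \<open>If the mixed derivatives differed at \<open>z\<close>, by continuity they would differ at any two points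
  close to \<open>z\<close>, against the equality of values provided by the second difference over a small
  parallelogram.\<close>

lemma dird_commute_real:
  fixes f :: "'a::real_normed_vector \<Rightarrow> real"
  assumes S: "open S" "z \<in> S" and f: "smooth_on S f"
  shows "dird u (dird v f) z = dird v (dird u f) z"
proof (rule ccontr)
  let ?A = "dird u (dird v f)" and ?B = "dird v (dird u f)"
  define d where "d = \<bar>?A z - ?B z\<bar> / 2"
  assume "?A z \<noteq> ?B z"
  then have d: "0 < d" by (simp add: d_def)
  have cont: "isCont ?A z" "isCont ?B z"
    using smooth_on_continuous_on[OF smooth_on_dird[OF smooth_on_dird[OF f]]] S
    by (auto simp: continuous_on_eq_continuous_at)
  obtain e1 e2 e3 where e: "0 < e1" "\<And>x. dist x z < e1 \<Longrightarrow> dist (?A x) (?A z) < d"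
    "0 < e2" "\<And>x. dist x z < e2 \<Longrightarrow> dist (?B x) (?B z) < d"
    "0 < e3" "ball z e3 \<subseteq> S"
    using cont d S by (metis continuous_at_eps_delta open_contains_ball)
  define e where "e = min e1 (min e2 e3)"
  have e0: "0 < e" and eS: "ball z e \<subseteq> S" using e by (auto simp: e_def)
  \<comment> \<open>A side length for which the parallelogram stays inside the ball of radius \<open>e\<close>; the summand
    \<open>1\<close> guards against \<open>u = v = 0\<close>.\<close>
  define h where "h = e / (2 * (norm u + norm v + 1))"
  have n: "0 < norm u + norm v + 1" by (simp add: add_nonneg_pos)
  have h0: "0 < h" using e0 n by (simp add: h_def)
  have "h * (norm u + norm v) \<le> h * (norm u + norm v + 1)" using h0 by simp
  also have "\<dots> = e / 2" using n by (simp add: h_def field_simps)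
  finally have he: "h * (norm u + norm v) < e" using e0 by simp
  have dif: "f differentiable (at x)" "dird w f differentiable (at x)" if "x \<in> ball z e" for x w
    using that eS f by (auto intro: smooth_on_differentiable smooth_on_differentiable[OF smooth_on_dird])
  obtain p where p: "p \<in> ball z e" "f (z + h *\<^sub>R u + h *\<^sub>R v) - f (z + h *\<^sub>R u) - f (z + h *\<^sub>R v) + f z
      = h * h * ?B p"
    using mixed_difference_mvt[OF dif h0 he] by blast
  obtain q where q: "q \<in> ball z e" "f (z + h *\<^sub>R v + h *\<^sub>R u) - f (z + h *\<^sub>R v) - f (z + h *\<^sub>R u) + f z
      = h * h * ?A q"
    using mixed_difference_mvt[where u = v and v = u and z = z and e = e, OF dif h0] he
    by (metis add.commute)
  have "h * h * ?A q = h * h * ?B p"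
    using p(2) q(2) unfolding add.assoc add.commute[of "h *\<^sub>R v" "h *\<^sub>R u"] by linarith
  then have "?A q = ?B p" using h0 by simp
  moreover have "dist (?A q) (?A z) < d" "dist (?B p) (?B z) < d"
    using e p(1) q(1) by (auto simp: e_def dist_commute)
  ultimately show False
    by (simp add: d_def dist_real_def abs_real_def split: if_splits)
qed

lemma dird_commute:
  fixes f :: "'a::real_normed_vector \<Rightarrow> 'b::euclidean_space"
  assumes S: "open S" "z \<in> S" and f: "smooth_on S f"
  shows "dird u (dird v f) z = dird v (dird u f) z"
proof (rule euclidean_eqI)
  fix b :: 'b
  have sb: "smooth_on S (\<lambda>x. f x \<bullet> b)"
    using smooth_on_linear_fun[OF bounded_linear_inner_left S(1) f] .
  have *: "dird u (dird v f) z \<bullet> b = dird u (dird v (\<lambda>x. f x \<bullet> b)) z" for u v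
  proof -
    have "dird u (dird v f) z \<bullet> b = dird u (\<lambda>x. dird v f x \<bullet> b) z"
      using smooth_on_differentiable[OF smooth_on_dird[OF f] S(2)]
      by (simp add: dird_linear_fun[OF bounded_linear_inner_left])
    also have "\<dots> = dird u (dird v (\<lambda>x. f x \<bullet> b)) z"
      by (rule dird_cong_open[OF S])
        (use smooth_on_differentiable[OF f] in \<open>simp add: dird_linear_fun[OF bounded_linear_inner_left]\<close>)
    finally show ?thesis .
  qed
  show "dird u (dird v f) z \<bullet> b = dird v (dird u f) z \<bullet> b"
    unfolding * by (rule dird_commute_real[OF S sb])
qed

section \<open>Geodesic sprays without coordinates\<close>

text \<open>For the vector field \<open>S = y \<partial>\<^sub>x - 2 q \<partial>\<^sub>y\<close> at \<open>z = (x, y)\<close> this is the Euler--Lagrange equation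
  \<open>S (\<partial>G/\<partial>y) = \<partial>G/\<partial>x\<close>. It is phrased with directional derivatives in an arbitrary
  Euclidean space so that it also applies to a product of two coordinate spaces, where the splitting
  of a product metric is visible.\<close>

definition geodesic_eq ::
  "('e::euclidean_space \<times> 'e \<Rightarrow> real) \<Rightarrow> 'e \<times> 'e \<Rightarrow> 'e \<Rightarrow> bool"
  where "geodesic_eq G z q \<longleftrightarrow>
    (\<forall>w. dird (snd z, - 2 *\<^sub>R q) (dird (0, w) G) z = dird (w, 0) G z)"

definition fibre_nondegenerate :: "('e::euclidean_space \<times> 'e \<Rightarrow> real) \<Rightarrow> 'e \<times> 'e \<Rightarrow> bool"
  where "fibre_nondegenerate G z \<longleftrightarrow>
    (\<forall>u. (\<forall>w. dird (0, u) (dird (0, w) G) z = 0) \<longrightarrow> u = 0)"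

text \<open>The trace \<open>\<partial>G\<^sup>a/\<partial>y\<^sup>a\<close> of the fibre derivative of the spray coefficients. Half of its fibre Hessian is
  the mean Berwald curvature.\<close>

definition vertical_div :: "('e::euclidean_space \<times> 'e \<Rightarrow> 'e) \<Rightarrow> 'e \<times> 'e \<Rightarrow> real"
  where "vertical_div Q z = (\<Sum>b\<in>Basis. dird (0, b) Q z \<bullet> b)"

text \<open>A pointwise condition, the vanishing of the fibre Hessian at \<open>z\<close>; where it holds along a whole
  fibre, \<open>V\<close> is locally affine there.\<close>

definition fibre_affine_at :: "('e::euclidean_space \<times> 'e \<Rightarrow> real) \<Rightarrow> 'e \<times> 'e \<Rightarrow> bool"
  where "fibre_affine_at V z \<longleftrightarrow> (\<forall>u w. dird (0, u) (dird (0, w) V) z = 0)"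

text \<open>The equation is affine in \<open>q\<close>, and its linear part is the fibre Hessian. So the spray may be
  identified in any way that is convenient, without inverting a matrix.\<close>

lemma geodesic_eq_unique:
  assumes "open W" "z \<in> W" "smooth_on W G" "fibre_nondegenerate G z"
    and "geodesic_eq G z q" "geodesic_eq G z q'"
  shows "q = q'"
proof -
  have "dird (0, q - q') (dird (0, w) G) z = 0" for w
  proof -
    have dif: "dird (0, w) G differentiable (at z)"
      using assms by (auto intro: smooth_on_differentiable[OF smooth_on_dird])
    have "(snd z, - 2 *\<^sub>R q) = (snd z, - 2 *\<^sub>R q') + (-2) *\<^sub>R (0, q - q')"
      by (simp add: algebra_simps)
    then have "dird (snd z, - 2 *\<^sub>R q) (dird (0, w) G) z =
        dird (snd z, - 2 *\<^sub>R q') (dird (0, w) G) z - 2 * dird (0, q - q') (dird (0, w) G) z"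
      by (simp only: dird_add_dir[OF dif] dird_scaleR_dir[OF dif]) simp
    then show ?thesis using assms(5,6) by (simp add: geodesic_eq_def)
  qed
  then have "q - q' = 0" using assms(4) unfolding fibre_nondegenerate_def by blast
  then show ?thesis by simp
qed

lemma smooth_on_vertical_div:
  assumes "open W" "smooth_on W Q"
  shows "smooth_on W (vertical_div Q)"
  unfolding vertical_div_def[abs_def]
  by (intro smooth_on_sum smooth_on_linear_fun[OF bounded_linear_inner_left] smooth_on_dird assms)

section \<open>Spray coefficients in coordinates\<close>

lemma vec_expand: "(u :: real ^ 'n) = (\<Sum>i\<in>UNIV. u $ i *\<^sub>R axis i 1)"
  using basis_expansion[of u] by (simp add: scalar_mult_eq_scaleR)

lemma dird_vertical_expand:
  assumes "F differentiable (at z)"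
  shows "dird (0, u :: real ^ 'n) F z = (\<Sum>i\<in>UNIV. u $ i *\<^sub>R dird (0, axis i 1) F z)"
proof -
  have L: "linear (\<lambda>u. dird (0, u) F z)"
    using linear_compose[OF _ linear_dird[OF assms], of "\<lambda>u. (0, u)"]
    by (simp add: o_def linear_iff)
  then have "dird (0, \<Sum>i\<in>UNIV. u $ i *\<^sub>R axis i 1) F z = (\<Sum>i\<in>UNIV. u $ i *\<^sub>R dird (0, axis i 1) F z)"
    using linear_sum[OF L, of "\<lambda>i. u $ i *\<^sub>R axis i 1" UNIV] linear_cmul[OF L] by simp
  then show ?thesis by (simp flip: vec_expand)
qed

lemma dird_horizontal_expand:
  assumes "F differentiable (at z)"
  shows "dird (u :: real ^ 'n, 0) F z = (\<Sum>i\<in>UNIV. u $ i *\<^sub>R dird (axis i 1, 0) F z)"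
proof -
  have L: "linear (\<lambda>u. dird (u, 0) F z)"
    using linear_compose[OF _ linear_dird[OF assms], of "\<lambda>u. (u, 0)"]
    by (simp add: o_def linear_iff)
  then have "dird (\<Sum>i\<in>UNIV. u $ i *\<^sub>R axis i 1, 0) F z = (\<Sum>i\<in>UNIV. u $ i *\<^sub>R dird (axis i 1, 0) F z)"
    using linear_sum[OF L, of "\<lambda>i. u $ i *\<^sub>R axis i 1" UNIV] linear_cmul[OF L] by simp
  then show ?thesis by (simp flip: vec_expand)
qed

lemma smooth_on_det:
  fixes M :: "'a::real_normed_vector \<Rightarrow> real ^ 'n ^ 'n"
  assumes "open S" "\<And>i j. smooth_on S (\<lambda>z. M z $ i $ j)"
  shows "smooth_on S (\<lambda>z. det (M z))"
  unfolding det_def using assms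
  by (intro smooth_on_sum smooth_on_mult smooth_on_prod smooth_on_const) auto

lemma hess_mult_component:
  fixes G :: "(real ^ 'n::finite) \<times> (real ^ 'n) \<Rightarrow> real"
  assumes "open W" "z \<in> W" "smooth_on W G"
  shows "(hess G z *v u) $ a = dird (0, u) (dird (0, axis a 1) G) z"
proof -
  have "dird (0, u) (dird (0, axis a 1) G) z = (\<Sum>b\<in>UNIV. u $ b * pdy b (pdy a G) z)"
    using smooth_on_differentiable[OF smooth_on_dird[OF assms(3)] assms(2)]
    by (subst dird_vertical_expand) (simp_all add: pdy_def)
  also have "\<dots> = (\<Sum>b\<in>UNIV. pdy a (pdy b G) z * u $ b)"
    unfolding pdy_def by (simp add: dird_commute[OF assms] mult.commute)
  finally show ?thesis
    by (simp add: hess_def matrix_vector_mult_def)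
qed

lemma hess_quadratic_form:
  fixes G :: "(real ^ 'n::finite) \<times> (real ^ 'n) \<Rightarrow> real"
  assumes "open W" "z \<in> W" "smooth_on W G"
  shows "w \<bullet> (hess G z *v u) = dird (0, u) (dird (0, w) G) z"
proof -
  have "dird (0, u) (dird (0, w) G) z = dird (0, w) (dird (0, u) G) z"
    by (rule dird_commute[OF assms])
  also have "\<dots> = (\<Sum>a\<in>UNIV. w $ a * dird (0, axis a 1) (dird (0, u) G) z)"
    using smooth_on_differentiable[OF smooth_on_dird[OF assms(3)] assms(2)]
    by (subst dird_vertical_expand) simp_all
  also have "\<dots> = (\<Sum>a\<in>UNIV. w $ a * dird (0, u) (dird (0, axis a 1) G) z)"
    by (simp only: dird_commute[OF assms])
  finally show ?thesis
    by (simp add: inner_vec_def hess_mult_component[OF assms])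
qed

lemma fibre_nondegenerate_if_hess_pos:
  fixes G :: "(real ^ 'n::finite) \<times> (real ^ 'n) \<Rightarrow> real"
  assumes "open W" "z \<in> W" "smooth_on W G"
    and "\<And>v. v \<noteq> 0 \<Longrightarrow> 0 < v \<bullet> (hess G z *v v)"
  shows "fibre_nondegenerate G z"
  using assms(4) unfolding fibre_nondegenerate_def hess_quadratic_form[OF assms(1-3)] by force

lemma det_hess_nonzero:
  fixes G :: "(real ^ 'n::finite) \<times> (real ^ 'n) \<Rightarrow> real"
  assumes "open W" "z \<in> W" "smooth_on W G" "fibre_nondegenerate G z"
  shows "det (hess G z) \<noteq> 0"
proof -
  have "u = 0" if "hess G z *v u = 0" for u
    using assms(4) that hess_quadratic_form[OF assms(1-3), of _ u]
    by (simp add: fibre_nondegenerate_def)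
  then have "invertible (hess G z)"
    unfolding invertible_left_inverse matrix_left_invertible_ker by blast
  then show ?thesis by (simp add: invertible_det_nz)
qed

definition spray_vec :: "((real ^ 'n::finite) \<times> (real ^ 'n) \<Rightarrow> real) \<Rightarrow> (real ^ 'n) \<times> (real ^ 'n) \<Rightarrow> real ^ 'n"
  where "spray_vec G z = (\<chi> a. spray_coeff G a z)"

definition spray_rhs :: "((real ^ 'n::finite) \<times> (real ^ 'n) \<Rightarrow> real) \<Rightarrow> (real ^ 'n) \<times> (real ^ 'n) \<Rightarrow> real ^ 'n"
  where "spray_rhs G z = (\<chi> b. (\<Sum>g\<in>UNIV. pdy b (pdx g G) z * snd z $ g) - pdx b G z)"

lemma hess_mult_spray_vec:
  assumes "det (hess G z) \<noteq> 0"
  shows "hess G z *v (2 *\<^sub>R spray_vec G z) = spray_rhs G z"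
proof -
  have "2 *\<^sub>R spray_vec G z = matrix_inv (hess G z) *v spray_rhs G z"
    by (simp add: vec_eq_iff spray_vec_def spray_coeff_def spray_rhs_def matrix_vector_mult_def)
  moreover have "hess G z ** matrix_inv (hess G z) = mat 1"
    using assms someI_ex[of "\<lambda>B. hess G z ** B = mat 1 \<and> B ** hess G z = mat 1"]
    by (simp add: invertible_det_nz[symmetric] invertible_def matrix_inv_def)
  ultimately show ?thesis
    by (simp add: matrix_vector_mul_assoc)
qed

text \<open>By Cramer's rule the solution of the linear system for the spray coefficients is a quotient of
  determinants whose entries are derivatives of \<open>G\<close> or products of these with coordinates.\<close>

lemma smooth_on_spray_vec:
  fixes G :: "(real ^ 'n::finite) \<times> (real ^ 'n) \<Rightarrow> real"
  assumes W: "open W" and G: "smooth_on W G" and nd: "\<And>z. z \<in> W \<Longrightarrow> fibre_nondegenerate G z"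
  shows "smooth_on W (spray_vec G)"
proof -
  have det: "det (hess G z) \<noteq> 0" if "z \<in> W" for z
    by (rule det_hess_nonzero[OF W that G nd[OF that]])
  define N where "N k z = (\<chi> i j. if j = k then spray_rhs G z $ i else hess G z $ i $ j)" for k z
  have h: "smooth_on W (\<lambda>z. hess G z $ i $ j)" for i j
    unfolding hess_def pdy_def by (simp add: smooth_on_dird G)
  have y: "smooth_on W (\<lambda>z. snd z $ g)" for g :: 'n
    by (intro smooth_on_linear_fun[OF bounded_linear_vec_nth W] smooth_on_bounded_linear bounded_linear_snd)
  have r: "smooth_on W (\<lambda>z. spray_rhs G z $ i)" for i
  proof -
    have "smooth_on W (\<lambda>z. (\<Sum>g\<in>UNIV. pdy i (pdx g G) z * snd z $ g) + (- 1) * pdx i G z)"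
      unfolding pdy_def pdx_def
      by (intro smooth_on_add smooth_on_sum smooth_on_mult smooth_on_dird G W y smooth_on_const)
    then show ?thesis by (simp add: spray_rhs_def)
  qed
  have dN: "smooth_on W (\<lambda>z. det (N k z))" for k
  proof (rule smooth_on_det[OF W])
    show "smooth_on W (\<lambda>z. N k z $ i $ j)" for i j
      by (cases "j = k") (simp_all add: N_def h r)
  qed
  have dH: "smooth_on W (\<lambda>z. det (hess G z))"
    by (rule smooth_on_det[OF W h])
  show ?thesis
  proof (rule smooth_on_componentwise[OF W])
    fix b :: "real ^ 'n" assume "b \<in> Basis"
    then obtain k where b: "b = axis k 1" by (auto simp: Basis_vec_def)
    have "smooth_on W (\<lambda>z. (1/2) * (det (N k z) / det (hess G z)))"
      using det by (intro smooth_on_mult smooth_on_const smooth_on_divide W dN dH) auto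
    moreover have "(1/2) * (det (N k z) / det (hess G z)) = spray_vec G z \<bullet> b" if "z \<in> W" for z
    proof -
      have "2 *\<^sub>R spray_vec G z = (\<chi> k. det (N k z) / det (hess G z))"
        using cramer[OF det[OF that]] hess_mult_spray_vec[OF det[OF that]] unfolding N_def by blast
      then have "(2 *\<^sub>R spray_vec G z) $ k = det (N k z) / det (hess G z)" by simp
      then show ?thesis by (simp add: b inner_axis)
    qed
    ultimately show "smooth_on W (\<lambda>z. spray_vec G z \<bullet> b)"
      by (rule smooth_on_cong[OF _ W])
  qed
qed

text \<open>The defining formula of the spray coefficients takes the mixed derivatives in the order
  \<open>\<partial>\<^sub>y \<partial>\<^sub>x\<close>, the geodesic equation in the opposite one; apart from this, both express the same linear
  system with the fibre Hessian as its matrix.\<close>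

lemma geodesic_eq_spray_vec:
  fixes G :: "(real ^ 'n::finite) \<times> (real ^ 'n) \<Rightarrow> real"
  assumes W: "open W" "z \<in> W" and G: "smooth_on W G" and nd: "fibre_nondegenerate G z"
  shows "geodesic_eq G z (spray_vec G z)"
  unfolding geodesic_eq_def
proof
  fix w
  let ?q = "spray_vec G z"
  note dif = smooth_on_differentiable[OF _ W(2)]
  note d1 = dif[OF G] and d2 = dif[OF smooth_on_dird[OF G]]
  note comm = dird_commute[OF W G]
  have ax: "dird (snd z, - 2 *\<^sub>R ?q) (dird (0, axis a 1) G) z = pdx a G z" for a
  proof -
    have "(snd z, - 2 *\<^sub>R ?q) = (snd z, 0) + (-1) *\<^sub>R (0, 2 *\<^sub>R ?q)" by simp
    then have "dird (snd z, - 2 *\<^sub>R ?q) (dird (0, axis a 1) G) z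
        = dird (snd z, 0) (dird (0, axis a 1) G) z - dird (0, 2 *\<^sub>R ?q) (dird (0, axis a 1) G) z"
      by (simp only: dird_add_dir[OF d2] dird_scaleR_dir[OF d2]) simp
    also have "dird (0, 2 *\<^sub>R ?q) (dird (0, axis a 1) G) z = spray_rhs G z $ a"
      by (simp only: hess_mult_component[OF W G, symmetric]
        hess_mult_spray_vec[OF det_hess_nonzero[OF W G nd]])
    also have "dird (snd z, 0) (dird (0, axis a 1) G) z
        = (\<Sum>g\<in>UNIV. dird (axis g 1, 0) (dird (0, axis a 1) G) z * snd z $ g)"
      by (subst dird_horizontal_expand[OF d2]) (simp add: mult.commute)
    also have "\<dots> = (\<Sum>g\<in>UNIV. pdy a (pdx g G) z * snd z $ g)"
      unfolding pdy_def pdx_def by (simp only: comm[of "(axis _ 1, 0)" "(0, axis a 1)"])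
    finally show ?thesis by (simp add: spray_rhs_def)
  qed
  \<comment> \<open>Interchanging the derivatives makes the linearity in \<open>w\<close> available, which reduces the claim
    to coordinate vectors.\<close>
  have "dird (snd z, - 2 *\<^sub>R ?q) (dird (0, w) G) z = dird (0, w) (dird (snd z, - 2 *\<^sub>R ?q) G) z"
    by (rule comm)
  also have "\<dots> = (\<Sum>a\<in>UNIV. w $ a * dird (0, axis a 1) (dird (snd z, - 2 *\<^sub>R ?q) G) z)"
    by (subst dird_vertical_expand[OF d2]) simp
  also have "\<dots> = (\<Sum>a\<in>UNIV. w $ a * pdx a G z)"
    by (simp only: comm[of "(0, axis _ 1)"] ax)
  also have "\<dots> = dird (w, 0) G z"
    by (subst dird_horizontal_expand[OF d1]) (simp add: pdx_def)
  finally show "dird (snd z, - 2 *\<^sub>R ?q) (dird (0, w) G) z = dird (w, 0) G z" .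
qed

text \<open>In the contraction of the Berwald curvature the contracted index is the one differentiated first,
  so the sum over it can be moved inside the two other fibre derivatives, where it forms the vertical
  divergence.\<close>

lemma mean_berwald_zero_iff:
  fixes G :: "(real ^ 'n::finite) \<times> (real ^ 'n) \<Rightarrow> real"
  assumes W: "open W" "z \<in> W" and G: "smooth_on W G" and nd: "\<And>z. z \<in> W \<Longrightarrow> fibre_nondegenerate G z"
  shows "(\<forall>b g. mean_berwald G b g z = 0) \<longleftrightarrow> fibre_affine_at (vertical_div (spray_vec G)) z"
proof -
  let ?Q = "spray_vec G" and ?V = "vertical_div (spray_vec G)"
  note Q = smooth_on_spray_vec[OF W(1) G nd]
  note V = smooth_on_vertical_div[OF W(1) Q]
  have coeff: "spray_coeff G a = (\<lambda>z. ?Q z $ a)" for a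
    by (simp add: spray_vec_def)
  have Qa: "smooth_on W (spray_coeff G a)" for a
    unfolding coeff by (intro smooth_on_linear_fun[OF _ W(1) Q] bounded_linear_vec_nth)
  have V_eq: "?V x = (\<Sum>a\<in>UNIV. pdy a (spray_coeff G a) x)" if "x \<in> W" for x
  proof -
    have "?V x = (\<Sum>a\<in>UNIV. dird (0, axis a 1) ?Q x $ a)"
      unfolding vertical_div_def Basis_vec_def
      by (subst sum.UNION_disjoint) (auto simp: axis_eq_axis inner_axis)
    also have "\<dots> = (\<Sum>a\<in>UNIV. pdy a (spray_coeff G a) x)"
      unfolding coeff pdy_def
      using dird_linear_fun[OF bounded_linear_vec_nth smooth_on_differentiable[OF Q that]] by simp
    finally show ?thesis .
  qed
  have E: "mean_berwald G b g z = (1/2) * dird (0, axis b 1) (dird (0, axis g 1) ?V) z" for b g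
  proof -
    have D1: "pdy g ?V x = (\<Sum>a\<in>UNIV. pdy g (pdy a (spray_coeff G a)) x)" if "x \<in> W" for x
    proof -
      have "pdy g ?V x = pdy g (\<lambda>x. \<Sum>a\<in>UNIV. pdy a (spray_coeff G a) x) x"
        unfolding pdy_def[of g] by (rule dird_cong_open[OF W(1) that V_eq])
      then show ?thesis
        unfolding pdy_def using smooth_on_differentiable[OF smooth_on_dird[OF Qa] that]
        by (subst (asm) dird_sum) auto
    qed
    have "pdy b (pdy g ?V) z = pdy b (\<lambda>x. \<Sum>a\<in>UNIV. pdy g (pdy a (spray_coeff G a)) x) z"
      unfolding pdy_def[of b] by (rule dird_cong_open[OF W D1])
    also have "\<dots> = (\<Sum>a\<in>UNIV. pdy b (pdy g (pdy a (spray_coeff G a))) z)"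
      unfolding pdy_def using smooth_on_differentiable[OF smooth_on_dird[OF smooth_on_dird[OF Qa]] W(2)]
      by (intro dird_sum) auto
    finally show ?thesis by (simp add: mean_berwald_def berwald_def pdy_def)
  qed
  note d2 = smooth_on_differentiable[OF smooth_on_dird[OF V] W(2)]
  have expand: "dird (0, u) (dird (0, w) ?V) z
      = (\<Sum>b\<in>UNIV. u $ b * (\<Sum>g\<in>UNIV. w $ g * dird (0, axis b 1) (dird (0, axis g 1) ?V) z))" for u w
  proof -
    have "dird (0, axis b 1) (dird (0, w) ?V) z
        = (\<Sum>g\<in>UNIV. w $ g * dird (0, axis b 1) (dird (0, axis g 1) ?V) z)" for b
      by (simp only: dird_commute[OF W V, of "(0, axis b 1)"] dird_vertical_expand[OF d2, of w]
        real_scaleR_def)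
    then show ?thesis by (simp add: dird_vertical_expand[OF d2, of u])
  qed
  show ?thesis
  proof
    assume "\<forall>b g. mean_berwald G b g z = 0"
    then have "dird (0, axis b 1) (dird (0, axis g 1) ?V) z = 0" for b g
      by (simp add: E)
    then show "fibre_affine_at ?V z"
      unfolding fibre_affine_at_def by (intro allI, subst expand) simp
  qed (simp add: fibre_affine_at_def E)
qed

section \<open>Change of coordinates\<close>

text \<open>The coordinate expression of the differential, as a map of tangent bundles.\<close>

definition tangent_lift ::
  "('d::euclidean_space \<Rightarrow> 'e::euclidean_space) \<Rightarrow> 'd \<times> 'd \<Rightarrow> 'e \<times> 'e"
  where "tangent_lift \<phi> z = (\<phi> (fst z), dird (snd z) \<phi> (fst z))"

lemma smooth_on_tangent_lift:
  assumes "open S" "smooth_on S \<phi>"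
  shows "smooth_on (S \<times> UNIV) (tangent_lift \<phi>)"
proof -
  have o: "open (S \<times> UNIV)" using assms(1) by (simp add: open_Times)
  show ?thesis
    unfolding tangent_lift_def[abs_def]
    by (intro smooth_on_Pair[OF o] smooth_on_compose[OF o assms(1) _ _ assms(2)]
        smooth_on_dird_along[OF o assms(1) _ _ _ assms(2)]
        smooth_on_bounded_linear bounded_linear_fst bounded_linear_snd) auto
qed

lemma dird_tangent_lift:
  assumes "open S" "smooth_on S \<phi>" "fst z \<in> S"
  shows "dird v (tangent_lift \<phi>) z =
    (dird (fst v) \<phi> (fst z), dird (snd v) \<phi> (fst z) + dird (fst v) (dird (snd z) \<phi>) (fst z))"
proof -
  let ?S = "S \<times> (UNIV :: 'a set)"
  have o: "open ?S" using assms(1) by (simp add: open_Times)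
  have z: "z \<in> ?S" using assms(3) by (cases z) auto
  note f = bounded_linear_fst[THEN smooth_on_bounded_linear] and s = bounded_linear_snd[THEN smooth_on_bounded_linear]
  have fd: "fst differentiable (at z)"
    by (rule bounded_linear_imp_differentiable[OF bounded_linear_fst])
  have pd: "\<phi> differentiable (at (fst z))"
    by (rule smooth_on_differentiable[OF assms(2,3)])
  have sd: "(\<lambda>z. dird (snd z) \<phi> (fst z)) differentiable (at z)"
    by (rule smooth_on_differentiable[OF smooth_on_dird_along[OF o assms(1) _ s f assms(2)] z]) auto
  have "dird v (\<lambda>z. dird (snd z) \<phi> (fst z)) z =
      dird (dird v snd z) \<phi> (fst z) + dird (dird v fst z) (dird (snd z) \<phi>) (fst z)"
    by (rule dird_dird_along[OF o assms(1) _ s f assms(2) z]) auto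
  then show ?thesis
    unfolding tangent_lift_def[abs_def]
    by (simp add: dird_Pair[OF differentiable_compose_at[OF fd pd] sd] dird_compose[OF fd pd]
      dird_bounded_linear[OF bounded_linear_fst] dird_bounded_linear[OF bounded_linear_snd])
qed

text \<open>Sprays and their divergences transform by formulas whose coefficients depend on the base point.
  Fibre derivatives of such a formula are taken with the base point frozen.\<close>

lemma dird_fibre_cong:
  assumes "open W" "(x, y) \<in> W" "F differentiable (at (x, y))" "h differentiable (at y)"
    and "\<And>y'. (x, y') \<in> W \<Longrightarrow> F (x, y') = h y'"
  shows "dird (0, w) F (x, y) = dird w h y"
proof (rule dird_line_cong[OF assms(3,4)])
  have "continuous (at 0) (\<lambda>t::real. (x, y) + t *\<^sub>R (0, w))"
    by (intro continuous_intros)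
  then have "((\<lambda>t::real. (x, y) + t *\<^sub>R (0, w)) \<longlongrightarrow> (x, y) + 0 *\<^sub>R (0, w)) (nhds 0)"
    unfolding continuous_within
      tendsto_at_iff_tendsto_nhds[of "\<lambda>t::real. (x, y) + t *\<^sub>R (0, w)" 0] .
  then have "\<forall>\<^sub>F t in nhds (0::real). (x, y) + t *\<^sub>R (0, w) \<in> W"
    by (rule topological_tendstoD[OF _ assms(1)]) (simp add: assms(2))
  then show "\<forall>\<^sub>F t in nhds (0::real). F ((x, y) + t *\<^sub>R (0, w)) = h (y + t *\<^sub>R w)"
    by eventually_elim (use assms(5) in auto)
qed

lemma dird_linear_slice:
  assumes "F differentiable (at (x, J y))" "bounded_linear J"
  shows "(\<lambda>y. F (x, J y)) differentiable (at y)"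
    and "dird w (\<lambda>y. F (x, J y)) y = dird (0, J w) F (x, J y)"
proof -
  have J: "J differentiable (at y)" by (rule bounded_linear_imp_differentiable[OF assms(2)])
  have P: "(\<lambda>y. (x, J y)) differentiable (at y)"
    by (rule differentiable_Pair[OF differentiable_const J])
  show "(\<lambda>y. F (x, J y)) differentiable (at y)"
    by (rule differentiable_compose_at[OF P assms(1)])
  show "dird w (\<lambda>y. F (x, J y)) y = dird (0, J w) F (x, J y)"
    by (simp add: dird_compose[OF P assms(1)] dird_Pair[OF differentiable_const J]
      dird_bounded_linear[OF assms(2)])
qed

text \<open>Here \<open>J\<close> may relate spaces of different types, so the invariance of the trace is
  computed by expanding in both bases.\<close>

lemma trace_conjugate:
  fixes J :: "'d::euclidean_space \<Rightarrow> 'e::euclidean_space"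
  assumes J: "linear J" and K: "linear K" and KJ: "\<And>y. J (K y) = y" and L: "linear L"
  shows "(\<Sum>b\<in>Basis. K (L (J b)) \<bullet> b) = (\<Sum>c\<in>Basis. L c \<bullet> c)"
proof -
  have 1: "K (L (J b)) \<bullet> b = (\<Sum>c\<in>Basis. (L (J b) \<bullet> c) * (K c \<bullet> b))" for b
  proof -
    have "K (L (J b)) = K (\<Sum>c\<in>Basis. (L (J b) \<bullet> c) *\<^sub>R c)"
      by (simp add: euclidean_representation)
    also have "\<dots> = (\<Sum>c\<in>Basis. (L (J b) \<bullet> c) *\<^sub>R K c)"
      by (simp add: linear_sum[OF K] linear_cmul[OF K])
    finally show ?thesis by (simp add: inner_sum_left)
  qed
  have 2: "(\<Sum>b\<in>Basis. (L (J b) \<bullet> c) * (K c \<bullet> b)) = L c \<bullet> c" for c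
  proof -
    have "L c = L (J (\<Sum>b\<in>Basis. (K c \<bullet> b) *\<^sub>R b))"
      by (simp add: euclidean_representation KJ)
    also have "\<dots> = (\<Sum>b\<in>Basis. (K c \<bullet> b) *\<^sub>R L (J b))"
      by (simp add: linear_sum[OF J] linear_cmul[OF J] linear_sum[OF L] linear_cmul[OF L])
    finally show ?thesis by (simp add: inner_sum_left mult.commute)
  qed
  have "(\<Sum>b\<in>Basis. K (L (J b)) \<bullet> b) = (\<Sum>b\<in>Basis. \<Sum>c\<in>Basis. (L (J b) \<bullet> c) * (K c \<bullet> b))"
    by (simp only: 1)
  also have "\<dots> = (\<Sum>c\<in>Basis. L c \<bullet> c)"
    by (subst sum.swap) (simp only: 2)
  finally show ?thesis .
qed

text \<open>Two descriptions of one energy, related by a coordinate change \<open>\<phi>\<close> of the base and the induced one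
  of the fibres. The source and the target may have different types: the intended use has the
  coordinates of an arbitrary chart of a product manifold as source and pairs of coordinates of the
  factors as target.\<close>

locale coordinate_change =
  fixes S :: "'d::euclidean_space set" and \<phi> :: "'d \<Rightarrow> 'e::euclidean_space"
    and W :: "('d \<times> 'd) set" and W' :: "('e \<times> 'e) set"
    and G :: "'d \<times> 'd \<Rightarrow> real" and G' :: "'e \<times> 'e \<Rightarrow> real"
  assumes open_S: "open S" and smooth_\<phi>: "smooth_on S \<phi>"
    and bij_J: "\<And>x. x \<in> S \<Longrightarrow> bij (\<lambda>v. dird v \<phi> x)"
    and open_W: "open W" and W_sub: "\<And>z. z \<in> W \<Longrightarrow> fst z \<in> S"
    and open_W': "open W'" and maps_W: "\<And>z. z \<in> W \<Longrightarrow> tangent_lift \<phi> z \<in> W'"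
    and smooth_G': "smooth_on W' G'" and G_eq: "\<And>z. z \<in> W \<Longrightarrow> G z = G' (tangent_lift \<phi> z)"
    and nondeg': "\<And>z. z \<in> W' \<Longrightarrow> fibre_nondegenerate G' z"
begin

lemma smooth_lift: "smooth_on W (tangent_lift \<phi>)"
  using W_sub by (intro smooth_on_subset[OF smooth_on_tangent_lift[OF open_S smooth_\<phi>]]) auto

lemma smooth_G: "smooth_on W G"
  by (rule smooth_on_cong[OF smooth_on_compose[OF open_W open_W' maps_W smooth_lift smooth_G'] open_W])
    (simp_all add: G_eq)

lemma dird_G:
  assumes "z \<in> W"
  shows "dird v G z = dird (dird v (tangent_lift \<phi>) z) G' (tangent_lift \<phi> z)"
proof -
  have "dird v G z = dird v (\<lambda>z. G' (tangent_lift \<phi> z)) z"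
    by (rule dird_cong_open[OF open_W assms G_eq])
  then show ?thesis
    by (simp add: dird_compose smooth_on_differentiable[OF smooth_lift assms]
      smooth_on_differentiable[OF smooth_G' maps_W[OF assms]])
qed

lemma linear_J: "x \<in> S \<Longrightarrow> linear (\<lambda>v. dird v \<phi> x)"
  by (rule linear_dird[OF smooth_on_differentiable[OF smooth_\<phi>]])

text \<open>The first summand arises because a fixed fibre direction \<open>w\<close> corresponds to the direction
  \<open>dird w \<phi> x\<close>, which depends on the base point \<open>x\<close>.\<close>

lemma dird_dird_G:
  assumes z: "z \<in> W"
  shows "dird p (dird (0, w) G) z =
    dird (0, dird (fst p) (dird w \<phi>) (fst z)) G' (tangent_lift \<phi> z)
    + dird (dird p (tangent_lift \<phi>) z) (dird (0, dird w \<phi> (fst z)) G') (tangent_lift \<phi> z)"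
proof -
  let ?m = "\<lambda>z. (0, dird w \<phi> (fst z))"
  have J: "smooth_on W (\<lambda>z. dird w \<phi> (fst z))"
    by (rule smooth_on_compose[OF open_W open_S W_sub
      smooth_on_bounded_linear[OF bounded_linear_fst] smooth_on_dird[OF smooth_\<phi>]])
  have m: "smooth_on W ?m"
    by (rule smooth_on_Pair[OF open_W smooth_on_const J])
  have fd: "fst differentiable (at z)"
    by (rule bounded_linear_imp_differentiable[OF bounded_linear_fst])
  have "dird p (dird (0, w) G) z = dird p (\<lambda>z. dird (?m z) G' (tangent_lift \<phi> z)) z"
    by (rule dird_cong_open[OF open_W z])
      (simp add: dird_G dird_tangent_lift[OF open_S smooth_\<phi> W_sub]
        linear_0[OF linear_J[OF W_sub]] dird_zero_dir[OF smooth_on_differentiable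
          [OF smooth_on_dird[OF smooth_\<phi>] W_sub]])
  also have "\<dots> = dird (dird p ?m z) G' (tangent_lift \<phi> z)
      + dird (dird p (tangent_lift \<phi>) z) (dird (?m z) G') (tangent_lift \<phi> z)"
    by (rule dird_dird_along[OF open_W open_W' maps_W m smooth_lift smooth_G' z])
  also have "dird p ?m z = (0, dird (fst p) (dird w \<phi>) (fst z))"
    by (simp add: dird_Pair[OF differentiable_const smooth_on_differentiable[OF J z]]
      dird_compose[OF fd smooth_on_differentiable[OF smooth_on_dird[OF smooth_\<phi>] W_sub[OF z]]]
      dird_bounded_linear[OF bounded_linear_fst])
  finally show ?thesis .
qed

lemma surj_J: "x \<in> S \<Longrightarrow> \<exists>w. dird w \<phi> x = w'"
  using bij_J[of x] by (metis bij_is_surj surjD)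

lemma nondeg:
  assumes z: "z \<in> W"
  shows "fibre_nondegenerate G z"
  unfolding fibre_nondegenerate_def
proof (intro allI impI)
  fix u assume u: "\<forall>w. dird (0, u) (dird (0, w) G) z = 0"
  note x = W_sub[OF z] and z' = maps_W[OF z]
  have eq: "dird (0, u) (dird (0, w) G) z
      = dird (0, dird u \<phi> (fst z)) (dird (0, dird w \<phi> (fst z)) G') (tangent_lift \<phi> z)" for w
    using dird_zero_dir[OF smooth_on_differentiable[OF smooth_G' z']]
    by (simp add: dird_dird_G[OF z] dird_tangent_lift[OF open_S smooth_\<phi> x] linear_0[OF linear_J[OF x]]
      dird_zero_dir[OF smooth_on_differentiable[OF smooth_on_dird[OF smooth_\<phi>] x]] flip: zero_prod_def)
  have "dird (0, dird u \<phi> (fst z)) (dird (0, w') G') (tangent_lift \<phi> z) = 0" for w'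
    using u eq surj_J[OF x, of w'] by metis
  then have "dird u \<phi> (fst z) = 0"
    using nondeg'[OF z'] unfolding fibre_nondegenerate_def by blast
  then show "u = 0"
    using bij_J[OF x] linear_0[OF linear_J[OF x]] by (metis bij_is_inj injD)
qed

text \<open>Second derivatives of \<open>\<phi>\<close> enter both sides of the geodesic equation. On the left one of them is
  absorbed into the new spray, and the other one cancels against the right-hand side because second
  derivatives of \<open>\<phi>\<close> are symmetric.\<close>

lemma geodesic_eq_transfer:
  assumes z: "z \<in> W" and q: "geodesic_eq G z q"
  shows "geodesic_eq G' (tangent_lift \<phi> z)
    (dird q \<phi> (fst z) - (1/2) *\<^sub>R dird (snd z) (dird (snd z) \<phi>) (fst z))"
  unfolding geodesic_eq_def
proof
  fix w'
  note x = W_sub[OF z] and z' = maps_W[OF z]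
  let ?x = "fst z" and ?y = "snd z" and ?z' = "tangent_lift \<phi> z"
  obtain w where w: "dird w \<phi> ?x = w'" using surj_J[OF x] by blast
  note d1 = smooth_on_differentiable[OF smooth_G' z']
  let ?p = "(snd ?z', - 2 *\<^sub>R (dird q \<phi> ?x - (1/2) *\<^sub>R dird ?y (dird ?y \<phi>) ?x))"
  have p: "dird (?y, - 2 *\<^sub>R q) (tangent_lift \<phi>) z = ?p"
    by (simp add: dird_tangent_lift[OF open_S smooth_\<phi> x] tangent_lift_def
      linear_cmul[OF linear_J[OF x], of "-2" q, simplified] linear_neg[OF linear_J[OF x]]
      linear_cmul[OF linear_J[OF x]] algebra_simps)
  have "dird (0, dird ?y (dird w \<phi>) ?x) G' ?z' + dird ?p (dird (0, w') G') ?z'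
      = dird (w', dird w (dird ?y \<phi>) ?x) G' ?z'"
    using q[unfolded geodesic_eq_def, rule_format, of w]
    unfolding dird_dird_G[OF z, of "(?y, - 2 *\<^sub>R q)" w] dird_G[OF z, of "(w, 0)"] p w fst_conv
    by (simp add: dird_tangent_lift[OF open_S smooth_\<phi> x] linear_0[OF linear_J[OF x]] w)
  also have "\<dots> = dird (w', 0) G' ?z' + dird (0, dird w (dird ?y \<phi>) ?x) G' ?z'"
    by (simp flip: dird_add_dir[OF d1])
  also have "dird w (dird ?y \<phi>) ?x = dird ?y (dird w \<phi>) ?x"
    by (rule dird_commute[OF open_S x smooth_\<phi>])
  finally show "dird ?p (dird (0, w') G') ?z' = dird (w', 0) G' ?z'" by simp
qed

context
  fixes Q :: "'d \<times> 'd \<Rightarrow> 'd" and Q' :: "'e \<times> 'e \<Rightarrow> 'e"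
  assumes smooth_Q: "smooth_on W Q" and Q: "\<And>z. z \<in> W \<Longrightarrow> geodesic_eq G z (Q z)"
    and smooth_Q': "smooth_on W' Q'" and Q': "\<And>z. z \<in> W' \<Longrightarrow> geodesic_eq G' z (Q' z)"
begin

lemma spray_transform:
  assumes z: "z \<in> W"
  shows "dird (Q z) \<phi> (fst z)
    = Q' (tangent_lift \<phi> z) + (1/2) *\<^sub>R dird (snd z) (dird (snd z) \<phi>) (fst z)"
  using geodesic_eq_unique[OF open_W' maps_W[OF z] smooth_G' nondeg'[OF maps_W[OF z]]
      geodesic_eq_transfer[OF z Q[OF z]] Q'[OF maps_W[OF z]]]
  by (simp add: algebra_simps)

lemma bilinear_second_derivative:
  assumes x: "x \<in> S"
  shows "bounded_bilinear (\<lambda>u v. dird u (dird v \<phi>) x)"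
proof -
  have "linear (\<lambda>u. dird u (dird v \<phi>) x)" for v
    by (rule linear_dird[OF smooth_on_differentiable[OF smooth_on_dird[OF smooth_\<phi>] x]])
  moreover have "dird u (dird v \<phi>) x = dird v (dird u \<phi>) x" for u v
    by (rule dird_commute[OF open_S x smooth_\<phi>])
  ultimately show ?thesis
    by (simp add: bilinear_conv_bounded_bilinear[symmetric] bilinear_def)
qed

text \<open>The correction term in the transformation of the spray is quadratic in \<open>y\<close>; its fibre derivative is
  a polar form, linear in \<open>y\<close>.\<close>

lemma vertical_derivative_transform:
  assumes z: "(x, y) \<in> W"
  shows "dird (dird (0, b) Q (x, y)) \<phi> x
    = dird (0, dird b \<phi> x) Q' (tangent_lift \<phi> (x, y)) + dird b (dird y \<phi>) x"
proof -
  let ?B = "\<lambda>u v. dird u (dird v \<phi>) x" and ?J = "\<lambda>v. dird v \<phi> x"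
  have x: "x \<in> S" using W_sub[OF z] by simp
  have J: "bounded_linear ?J"
    by (simp add: linear_conv_bounded_linear[symmetric] linear_J[OF x])
  note B = bilinear_second_derivative[OF x]
  have dQ: "Q differentiable (at (x, y))" by (rule smooth_on_differentiable[OF smooth_Q z])
  have dQ': "Q' differentiable (at (\<phi> x, ?J y))"
    using smooth_on_differentiable[OF smooth_Q' maps_W[OF z]] by (simp add: tangent_lift_def)
  have id: "(\<lambda>y::'d. y) differentiable (at y)" by simp
  note sl = dird_linear_slice[where J = ?J, OF dQ' J]
  note bl = differentiable_linear_fun[OF bounded_linear_scaleR_right[of "1/2::real"] differentiable_bilinear[OF B id id]]
  have "?J (dird (0, b) Q (x, y)) = dird (0, b) (\<lambda>z. ?J (Q z)) (x, y)"
    by (rule dird_linear_fun[OF J dQ, symmetric])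
  also have "\<dots> = dird b (\<lambda>y. Q' (\<phi> x, ?J y) + (1/2) *\<^sub>R ?B y y) y"
  proof (rule dird_fibre_cong[OF open_W z differentiable_linear_fun[OF J dQ]])
    show "(\<lambda>y. Q' (\<phi> x, ?J y) + (1/2) *\<^sub>R ?B y y) differentiable (at y)"
      using sl(1) bl by (rule differentiable_add)
    show "?J (Q (x, y')) = Q' (\<phi> x, ?J y') + (1/2) *\<^sub>R ?B y' y'" if "(x, y') \<in> W" for y'
      using spray_transform[OF that] by (simp add: tangent_lift_def)
  qed
  also have "\<dots> = dird (0, ?J b) Q' (\<phi> x, ?J y) + (1/2) *\<^sub>R (?B y b + ?B b y)"
    by (simp only: dird_add[OF sl(1) bl] sl(2)
      dird_linear_fun[OF bounded_linear_scaleR_right differentiable_bilinear[OF B id id]]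
      dird_bilinear[OF B id id] dird_bounded_linear[OF bounded_linear_ident])
  also have "?B y b = ?B b y"
    by (rule dird_commute[OF open_S x smooth_\<phi>])
  finally show ?thesis by (simp add: tangent_lift_def flip: scaleR_2)
qed

text \<open>Taking the trace of the fibre derivative removes the Jacobian by conjugation invariance. The
  correction that remains is linear in \<open>y\<close>, hence invisible to second fibre derivatives.\<close>

lemma vertical_div_transform:
  assumes x: "x \<in> S"
  obtains \<mu> where "bounded_linear \<mu>"
    "\<And>y. (x, y) \<in> W \<Longrightarrow> vertical_div Q (x, y) = vertical_div Q' (tangent_lift \<phi> (x, y)) + \<mu> y"
proof -
  let ?B = "\<lambda>u v. dird u (dird v \<phi>) x" and ?J = "\<lambda>v. dird v \<phi> x"
  define K where "K = inv ?J"
  have KJ: "K (?J v) = v" and JK: "?J (K w) = w" for v w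
    unfolding K_def
    by (rule inv_f_f[OF bij_is_inj[OF bij_J[OF x]]], rule surj_f_inv_f[OF bij_is_surj[OF bij_J[OF x]]])
  have K: "linear K"
  proof (rule linearI)
    show "K (a + b) = K a + K b" for a b
      using KJ[of "K a + K b"] linear_add[OF linear_J[OF x], of "K a" "K b"] by (simp add: JK)
    show "K (r *\<^sub>R a) = r *\<^sub>R K a" for r a
      using KJ[of "r *\<^sub>R K a"] linear_cmul[OF linear_J[OF x], of r "K a"] by (simp add: JK)
  qed
  define \<mu> where "\<mu> y = (\<Sum>b\<in>Basis. K (?B b y) \<bullet> b)" for y
  have "linear (\<lambda>y. ?B b y)" for b
    using bilinear_second_derivative[OF x] by (simp add: bilinear_conv_bounded_bilinear[symmetric] bilinear_def)
  then have "linear (\<lambda>y. K (?B b y) \<bullet> b)" for b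
    using linear_compose[OF linear_compose[OF _ K], of "\<lambda>y. ?B b y" "\<lambda>v. v \<bullet> b"]
    by (simp add: o_def linear_iff inner_add_left)
  then have "linear \<mu>"
    unfolding \<mu>_def[abs_def] by (intro linear_compose_sum) auto
  then have lin: "bounded_linear \<mu>" by (simp add: linear_conv_bounded_linear)
  moreover have "vertical_div Q (x, y) = vertical_div Q' (tangent_lift \<phi> (x, y)) + \<mu> y"
    if z: "(x, y) \<in> W" for y
  proof -
    let ?L = "\<lambda>w. dird (0, w) Q' (tangent_lift \<phi> (x, y))"
    have "linear (\<lambda>w. dird w Q' (tangent_lift \<phi> (x, y)))"
      by (rule linear_dird[OF smooth_on_differentiable[OF smooth_Q' maps_W[OF z]]])
    from linear_compose[OF _ this, of "\<lambda>w. (0, w)"]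
    have L: "linear ?L" by (simp add: o_def linear_iff)
    have "dird (0, b) Q (x, y) = K (?L (?J b)) + K (?B b y)" for b
      using arg_cong[OF vertical_derivative_transform[OF z, of b], of K]
      by (simp only: KJ linear_add[OF K])
    then have "vertical_div Q (x, y) = (\<Sum>b\<in>Basis. K (?L (?J b)) \<bullet> b) + \<mu> y"
      by (simp add: vertical_div_def \<mu>_def inner_add_left sum.distrib)
    also have "(\<Sum>b\<in>Basis. K (?L (?J b)) \<bullet> b) = vertical_div Q' (tangent_lift \<phi> (x, y))"
      using trace_conjugate[OF linear_J[OF x] K JK L] by (simp add: vertical_div_def)
    finally show ?thesis .
  qed
  ultimately show ?thesis using that by blast
qed

text \<open>This is the tensor character of the mean Berwald curvature: its components in the two
  descriptions are related by the Jacobian alone, which is invertible.\<close>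

lemma fibre_affine_transform:
  assumes z: "z \<in> W"
  shows "fibre_affine_at (vertical_div Q) z \<longleftrightarrow> fibre_affine_at (vertical_div Q') (tangent_lift \<phi> z)"
proof -
  let ?V = "vertical_div Q" and ?V' = "vertical_div Q'"
  obtain x y where xy: "z = (x, y)" by (cases z)
  let ?J = "\<lambda>v. dird v \<phi> x"
  have x: "x \<in> S" using W_sub[OF z] xy by simp
  have J: "bounded_linear ?J"
    by (simp add: linear_conv_bounded_linear[symmetric] linear_J[OF x])
  note V = smooth_on_vertical_div[OF open_W smooth_Q]
    and V' = smooth_on_vertical_div[OF open_W' smooth_Q']
  obtain \<mu> where lin: "bounded_linear \<mu>"
    and eq: "\<And>y. (x, y) \<in> W \<Longrightarrow> ?V (x, y) = ?V' (tangent_lift \<phi> (x, y)) + \<mu> y"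
    using vertical_div_transform[OF x] by blast
  have in': "(\<phi> x, ?J y) \<in> W'" if "(x, y) \<in> W" for y
    using maps_W[OF that] by (simp add: tangent_lift_def)
  have first: "dird (0, w) ?V (x, y) = dird (0, ?J w) ?V' (\<phi> x, ?J y) + \<mu> w" if "(x, y) \<in> W" for y w
  proof -
    note sl = dird_linear_slice[where J = ?J, OF smooth_on_differentiable[OF V' in'[OF that]] J]
    have dl: "\<mu> differentiable (at y)" by (rule bounded_linear_imp_differentiable[OF lin])
    have "dird (0, w) ?V (x, y) = dird w (\<lambda>y. ?V' (\<phi> x, ?J y) + \<mu> y) y"
      using eq by (intro dird_fibre_cong[OF open_W that smooth_on_differentiable[OF V that]]
        differentiable_add sl(1) dl) (simp add: tangent_lift_def)
    then show ?thesis
      by (simp only: dird_add[OF sl(1) dl] sl(2) dird_bounded_linear[OF lin])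
  qed
  have second: "dird (0, u) (dird (0, w) ?V) (x, y)
      = dird (0, ?J u) (dird (0, ?J w) ?V') (\<phi> x, ?J y)" for u w
  proof -
    note z = z[unfolded xy]
    note sl = dird_linear_slice[where J = ?J, OF smooth_on_differentiable
        [OF smooth_on_dird[OF V'] in'[OF z]] J]
    have "dird (0, u) (dird (0, w) ?V) (x, y) = dird u (\<lambda>y. dird (0, ?J w) ?V' (\<phi> x, ?J y) + \<mu> w) y"
      using first by (intro dird_fibre_cong[OF open_W z smooth_on_differentiable[OF smooth_on_dird[OF V] z]]
        differentiable_add sl(1) differentiable_const) simp
    then show ?thesis
      by (simp only: dird_add[OF sl(1) differentiable_const] sl(2) dird_const add_0_right)
  qed
  have "(\<forall>u w. dird (0, ?J u) (dird (0, ?J w) ?V') (\<phi> x, ?J y) = 0)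
      \<longleftrightarrow> (\<forall>u w. dird (0, u) (dird (0, w) ?V') (\<phi> x, ?J y) = 0)"
    using surj_J[OF x] by metis
  then show ?thesis
    by (simp add: fibre_affine_at_def xy second tangent_lift_def)
qed

end

end

section \<open>Homogeneity\<close>

lemma euler_first:
  assumes "g differentiable (at z)" and "\<forall>\<^sub>F t in nhds (0::real). g (z + t *\<^sub>R u) = (1 + t) ^ d * g z"
  shows "dird u g z = real d * g z"
proof -
  obtain S where S: "open S" "0 \<in> S" "\<And>t. t \<in> S \<Longrightarrow> g (z + t *\<^sub>R u) = (1 + t) ^ d * g z"
    using assms(2) unfolding eventually_nhds by blast
  have "((\<lambda>t. (1 + t) ^ d * g z) has_vector_derivative dird u g z) (at 0)"
    by (rule has_vector_derivative_transform_within_open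
      [OF has_vector_derivative_line[OF assms(1)] S])
  moreover have "((\<lambda>t. (1 + t) ^ d * g z) has_vector_derivative real d * g z) (at 0)"
    unfolding has_real_derivative_iff_has_vector_derivative[symmetric]
    by (auto intro!: derivative_eq_intros)
  ultimately show ?thesis by (rule vector_derivative_unique_at)
qed

text \<open>Differentiating Euler's relation once more. The linear vector field \<open>m\<close> is the radial one, either
  of the whole space or of the fibres.\<close>

lemma euler_second:
  fixes g :: "'a::euclidean_space \<Rightarrow> real"
  assumes W: "open W" "z \<in> W" and g: "smooth_on W g" and m: "bounded_linear m"
    and hom: "\<And>z. z \<in> W \<Longrightarrow> dird (m z) g z = d * g z"
  shows "dird v (dird (m z) g) z = d * dird v g z - dird (m v) g z"
proof -
  note gd = smooth_on_differentiable[OF g W(2)]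
  have "d * dird v g z = dird v (\<lambda>z. d * g z) z"
    by (simp add: dird_linear_fun[OF bounded_linear_mult_right gd])
  also have "\<dots> = dird v (\<lambda>z. dird (m z) g z) z"
    by (rule dird_cong_open[OF W]) (simp add: hom)
  also have "\<dots> = dird (dird v m z) g z + dird (dird v (\<lambda>z. z) z) (dird (m z) g) z"
    by (rule dird_dird_along[OF W(1) W(1) _ smooth_on_bounded_linear[OF m]
      smooth_on_bounded_linear[OF bounded_linear_ident] g W(2)])
  finally show ?thesis
    by (simp add: dird_bounded_linear[OF m] dird_bounded_linear[OF bounded_linear_ident])
qed

locale homogeneous_energy =
  fixes W :: "('e::euclidean_space \<times> 'e) set" and K :: "'e \<times> 'e \<Rightarrow> real"
  assumes open_W: "open W" and smooth_K: "smooth_on W K"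
    and pos_K: "\<And>z. z \<in> W \<Longrightarrow> 0 < K z"
    and hom_K: "\<And>x y r. (x, y) \<in> W \<Longrightarrow> K (x, r *\<^sub>R y) = r\<^sup>2 * K (x, y)"
    and nondeg_K: "\<And>z. z \<in> W \<Longrightarrow> fibre_nondegenerate K z"
begin

lemma dif: "z \<in> W \<Longrightarrow> K differentiable (at z)"
  by (rule smooth_on_differentiable[OF smooth_K])

lemma dif2: "z \<in> W \<Longrightarrow> dird v K differentiable (at z)"
  by (rule smooth_on_differentiable[OF smooth_on_dird[OF smooth_K]])

lemma euler_K:
  assumes "z \<in> W"
  shows "dird (0, snd z) K z = 2 * K z"
proof -
  have "K (z + t *\<^sub>R (0, snd z)) = (1 + t) ^ 2 * K z" for t :: real
    using hom_K[of "fst z" "snd z" "1 + t"] assms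
    by (cases z) (simp add: scaleR_left_distrib)
  then show ?thesis using euler_first[OF dif[OF assms], of "(0, snd z)" 2] by simp
qed

lemma euler_dird_K:
  assumes "z \<in> W"
  shows "dird v (dird (0, snd z) K) z = 2 * dird v K z - dird (0, snd v) K z"
  using euler_second[OF open_W assms smooth_K, of "\<lambda>z. (0, snd z)" 2 v] euler_K
  by (simp add: bounded_linear_Pair bounded_linear_snd bounded_linear_zero)

lemma euler_fibre_hessian:
  assumes "z \<in> W"
  shows "dird (0, snd z) (dird (0, w) K) z = dird (0, w) K z"
  using euler_dird_K[OF assms, of "(0, w)"] dird_commute[OF open_W assms smooth_K] by simp

text \<open>Let \<open>S\<close> be the spray. Applying \<open>S\<close> to Euler's relation \<open>y \<partial>K/\<partial>y = 2 K\<close> gives \<open>S K = 2 S K\<close>, since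
  by the geodesic equation the left-hand side becomes \<open>-2 q \<partial>K/\<partial>y + y \<partial>K/\<partial>x = S K\<close>.\<close>

lemma energy_conserved:
  assumes z: "z \<in> W" and q: "geodesic_eq K z q"
  shows "dird (snd z, - 2 *\<^sub>R q) K z = 0"
proof -
  let ?p = "(snd z, - 2 *\<^sub>R q)"
  have split: "?p = (snd z, 0) + (0, - 2 *\<^sub>R q)" by simp
  have "dird ?p K z = dird (snd z, 0) K z + dird (0, - 2 *\<^sub>R q) K z"
    unfolding split by (rule dird_add_dir[OF dif[OF z]])
  moreover have "dird ?p (dird (0, snd z) K) z = dird (snd z, 0) K z"
    using q unfolding geodesic_eq_def by blast
  ultimately show ?thesis using euler_dird_K[OF z, of ?p] by simp
qed

end

section \<open>Minkowskian products of energies\<close>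

definition proj1 :: "('d::euclidean_space \<times> 'e::euclidean_space) \<times> ('d \<times> 'e) \<Rightarrow> 'd \<times> 'd"
  where "proj1 z = (fst (fst z), fst (snd z))"

definition proj2 :: "('d::euclidean_space \<times> 'e::euclidean_space) \<times> ('d \<times> 'e) \<Rightarrow> 'e \<times> 'e"
  where "proj2 z = (snd (fst z), snd (snd z))"

lemma proj_simps [simp]:
  "proj1 (x, y) = (fst x, fst y)" "proj2 (x, y) = (snd x, snd y)"
  "snd (proj1 z) = fst (snd z)" "snd (proj2 z) = snd (snd z)"
  by (simp_all add: proj1_def proj2_def)

lemma bounded_linear_proj1: "bounded_linear proj1"
  unfolding proj1_def[abs_def]
  by (intro bounded_linear_Pair bounded_linear_compose[OF bounded_linear_fst]
    bounded_linear_fst bounded_linear_snd)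

lemma bounded_linear_proj2: "bounded_linear proj2"
  unfolding proj2_def[abs_def]
  by (intro bounded_linear_Pair bounded_linear_compose[OF bounded_linear_snd]
    bounded_linear_fst bounded_linear_snd)

lemma sum_Basis_prod:
  "(\<Sum>b\<in>(Basis :: ('d::euclidean_space \<times> 'e::euclidean_space) set). g b) =
    (\<Sum>b\<in>Basis. g (b, 0)) + (\<Sum>b\<in>Basis. g (0, b))"
proof -
  have "inj_on (\<lambda>u. (u :: 'd, 0 :: 'e)) Basis" "inj_on (\<lambda>u. (0 :: 'd, u :: 'e)) Basis"
    by (auto intro!: inj_onI)
  then show ?thesis
    unfolding Basis_prod_def by (subst sum.union_disjoint) (auto simp: sum.reindex)
qed

abbreviation quadrant :: "(real \<times> real) set"
  where "quadrant \<equiv> {0<..} \<times> {0<..}"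

lemma open_quadrant: "open quadrant"
  by (simp add: open_Times)

lemma dird_compose_linear:
  assumes "bounded_linear p" "F differentiable (at (p z))"
  shows "dird v (\<lambda>z. F (p z)) z = dird (p v) F (p z)"
  using dird_compose[OF bounded_linear_imp_differentiable[OF assms(1)] assms(2)]
  by (simp add: dird_bounded_linear[OF assms(1)])

locale energy_product =
  E1: homogeneous_energy W1 K + E2: homogeneous_energy W2 H
  for W1 :: "('d::euclidean_space \<times> 'd) set" and K
    and W2 :: "('e::euclidean_space \<times> 'e) set" and H +
  fixes f :: "real \<times> real \<Rightarrow> real"
  assumes pf: "product_function f"
begin

definition W where "W = {z. proj1 z \<in> W1 \<and> proj2 z \<in> W2}"

definition energies where "energies z = (K (proj1 z), H (proj2 z))"

definition G where "G z = f (energies z)"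

lemma open_W: "open W"
proof -
  have "W = proj1 -` W1 \<inter> proj2 -` W2" by (auto simp: W_def)
  moreover have "continuous_on UNIV proj1" "continuous_on UNIV proj2"
    by (simp_all add: linear_continuous_on bounded_linear_proj1 bounded_linear_proj2)
  ultimately show ?thesis
    by (auto intro!: open_Int open_vimage E1.open_W E2.open_W)
qed

lemma W_D: "z \<in> W \<Longrightarrow> proj1 z \<in> W1" "z \<in> W \<Longrightarrow> proj2 z \<in> W2"
  by (simp_all add: W_def)

lemma smooth_f: "smooth_on quadrant f"
  using pf by (simp add: product_function_def)

lemma f_partials_nonzero: "\<forall>z\<in>quadrant. dird (1, 0) f z \<noteq> 0 \<and> dird (0, 1) f z \<noteq> 0"
  using pf[unfolded product_function_def, THEN conjunct2, THEN conjunct2, THEN conjunct2,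
    THEN conjunct2, THEN conjunct2, THEN conjunct1] .

lemma f_determinant_nonzero:
  "\<forall>z\<in>quadrant. dird (1, 0) f z * dird (0, 1) f z - 2 * f z * dird (1, 0) (dird (0, 1) f) z \<noteq> 0"
  using pf[unfolded product_function_def, THEN conjunct2, THEN conjunct2, THEN conjunct2,
    THEN conjunct2, THEN conjunct2, THEN conjunct2] .

lemma energies_quadrant: "z \<in> W \<Longrightarrow> energies z \<in> quadrant"
  using E1.pos_K E2.pos_K by (simp add: energies_def W_def)

lemma smooth_proj1: "smooth_on W1 F \<Longrightarrow> smooth_on W (\<lambda>z. F (proj1 z))"
  using smooth_on_compose[OF open_W E1.open_W W_D(1) smooth_on_bounded_linear[OF bounded_linear_proj1]] .

lemma smooth_proj2: "smooth_on W2 F \<Longrightarrow> smooth_on W (\<lambda>z. F (proj2 z))"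
  using smooth_on_compose[OF open_W E2.open_W W_D(2) smooth_on_bounded_linear[OF bounded_linear_proj2]] .

lemma smooth_energies: "smooth_on W energies"
  unfolding energies_def[abs_def]
  by (intro smooth_on_Pair open_W smooth_proj1 smooth_proj2 E1.smooth_K E2.smooth_K)

lemma smooth_G: "smooth_on W G"
  unfolding G_def[abs_def]
  by (rule smooth_on_compose[OF open_W open_quadrant energies_quadrant smooth_energies smooth_f])

lemma dird_pair_proj:
  assumes "z \<in> W" "smooth_on W1 F1" "smooth_on W2 F2"
  shows "dird v (\<lambda>z. (F1 (proj1 z), F2 (proj2 z))) z = (dird (proj1 v) F1 (proj1 z), dird (proj2 v) F2 (proj2 z))"
  using assms
  by (simp add: dird_Pair smooth_on_differentiable[OF smooth_proj1] smooth_on_differentiable[OF smooth_proj2]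
    dird_compose_linear[OF bounded_linear_proj1] dird_compose_linear[OF bounded_linear_proj2]
    smooth_on_differentiable W_D)

lemma dird_energies:
  "z \<in> W \<Longrightarrow> dird v energies z = (dird (proj1 v) K (proj1 z), dird (proj2 v) H (proj2 z))"
  unfolding energies_def[abs_def] by (rule dird_pair_proj[OF _ E1.smooth_K E2.smooth_K])

lemma dird_G:
  assumes "z \<in> W"
  shows "dird v G z = dird (dird (proj1 v) K (proj1 z), dird (proj2 v) H (proj2 z)) f (energies z)"
  unfolding G_def[abs_def]
  by (simp add: dird_compose smooth_on_differentiable[OF smooth_energies assms]
    smooth_on_differentiable[OF smooth_f energies_quadrant[OF assms]] dird_energies[OF assms])

lemma dird_dird_G:
  assumes z: "z \<in> W"
  shows "dird p (dird v G) z =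
    dird (dird (proj1 p) (dird (proj1 v) K) (proj1 z), dird (proj2 p) (dird (proj2 v) H) (proj2 z)) f (energies z)
    + dird (dird (proj1 p) K (proj1 z), dird (proj2 p) H (proj2 z))
        (dird (dird (proj1 v) K (proj1 z), dird (proj2 v) H (proj2 z)) f) (energies z)"
proof -
  let ?m = "\<lambda>z. (dird (proj1 v) K (proj1 z), dird (proj2 v) H (proj2 z))"
  note s = smooth_on_dird[OF E1.smooth_K] smooth_on_dird[OF E2.smooth_K]
  have m: "smooth_on W ?m"
    by (intro smooth_on_Pair open_W smooth_proj1 smooth_proj2 s)
  have "dird p (dird v G) z = dird p (\<lambda>z. dird (?m z) f (energies z)) z"
    by (rule dird_cong_open[OF open_W z]) (simp add: dird_G)
  also have "\<dots> = dird (dird p ?m z) f (energies z) + dird (dird p energies z) (dird (?m z) f) (energies z)"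
    by (rule dird_dird_along[OF open_W open_quadrant energies_quadrant m smooth_energies smooth_f z])
  finally show ?thesis
    by (simp add: dird_pair_proj[OF z s] dird_energies[OF z])
qed

text \<open>The derivatives \<open>\<partial>f/\<partial>s\<close> and \<open>\<partial>f/\<partial>t\<close> depend on \<open>z\<close> only through \<open>K\<close> and \<open>H\<close>, which the sprays of
  the factors leave invariant. Along the product of the two sprays they behave like constants, and
  the geodesic equation of \<open>f(K, H)\<close> splits into those of \<open>K\<close> and \<open>H\<close>.\<close>

lemma geodesic_eq_product:
  assumes z: "z \<in> W" and q1: "geodesic_eq K (proj1 z) q1" and q2: "geodesic_eq H (proj2 z) q2"
  shows "geodesic_eq G z (q1, q2)"
  unfolding geodesic_eq_def
proof
  fix w :: "'d \<times> 'e"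
  let ?p = "(snd z, - 2 *\<^sub>R (q1, q2))"
  note z12 = W_D[OF z]
  have f0: "dird 0 (dird u f) (energies z) = 0" for u
    by (rule dird_zero_dir[OF smooth_on_differentiable[OF smooth_on_dird[OF smooth_f] energies_quadrant[OF z]]])
  have p: "proj1 ?p = (snd (proj1 z), - 2 *\<^sub>R q1)" "proj2 ?p = (snd (proj2 z), - 2 *\<^sub>R q2)" by simp_all
  have w: "proj1 (0, w) = (0, fst w)" "proj2 (0, w) = (0, snd w)" 
    "proj1 (w, 0) = (fst w, 0)" "proj2 (w, 0) = (snd w, 0)" by simp_all
  have e: "dird (proj1 ?p) K (proj1 z) = 0" "dird (proj2 ?p) H (proj2 z) = 0"
    unfolding p using E1.energy_conserved[OF z12(1) q1] E2.energy_conserved[OF z12(2) q2] by blast+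
  have g: "dird (proj1 ?p) (dird (0, fst w) K) (proj1 z) = dird (fst w, 0) K (proj1 z)"
    "dird (proj2 ?p) (dird (0, snd w) H) (proj2 z) = dird (snd w, 0) H (proj2 z)"
    unfolding p using q1 q2 unfolding geodesic_eq_def by blast+
  show "dird ?p (dird (0, w) G) z = dird (w, 0) G z"
    unfolding dird_dird_G[OF z] dird_G[OF z] e w g f0[unfolded zero_prod_def] by simp
qed

lemma dird_f_pair:
  assumes "x \<in> quadrant"
  shows "dird (a, b) f x = a * dird (1, 0) f x + b * dird (0, 1) f x"
    and "dird (a, b) (dird v f) x = a * dird (1, 0) (dird v f) x + b * dird (0, 1) (dird v f) x"
proof -
  have *: "(a, b) = a *\<^sub>R (1, 0) + b *\<^sub>R (0, 1)" by simp
  have d: "F differentiable (at x) \<Longrightarrow> dird (a, b) F x = a * dird (1, 0) F x + b * dird (0, 1) F x"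
    for F :: "real \<times> real \<Rightarrow> real"
    unfolding * by (simp only: dird_add_dir dird_scaleR_dir real_scaleR_def)
  show "dird (a, b) f x = a * dird (1, 0) f x + b * dird (0, 1) f x"
    by (rule d[OF smooth_on_differentiable[OF smooth_f assms]])
  show "dird (a, b) (dird v f) x = a * dird (1, 0) (dird v f) x + b * dird (0, 1) (dird v f) x"
    by (rule d[OF smooth_on_differentiable[OF smooth_on_dird[OF smooth_f] assms]])
qed

lemma euler_f:
  assumes x: "x \<in> quadrant"
  shows "dird x f x = f x" and "dird v (dird x f) x = 0"
proof -
  have e: "dird x f x = f x" if x: "x \<in> quadrant" for x
  proof -
    have "f (x + t *\<^sub>R x) = (1 + t) ^ 1 * f x" if "-1 < t" for t
    proof -
      have "f ((1 + t) * fst x, (1 + t) * snd x) = (1 + t) * f (fst x, snd x)"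
        using pf x that unfolding product_function_def by (auto simp: mem_Times_iff)
      then show ?thesis by (cases x) (simp add: algebra_simps)
    qed
    moreover have "\<forall>\<^sub>F t in nhds (0::real). -1 < t"
      using eventually_nhds_in_open[of "{-1<..}" "0::real"] by simp
    ultimately have "\<forall>\<^sub>F t in nhds 0. f (x + t *\<^sub>R x) = (1 + t) ^ 1 * f x"
      by (auto elim: eventually_mono)
    then show ?thesis
      using euler_first[OF smooth_on_differentiable[OF smooth_f x]] by fastforce
  qed
  show "dird x f x = f x" by (rule e[OF x])
  show "dird v (dird x f) x = 0"
    using euler_second[OF open_quadrant x smooth_f bounded_linear_ident, of 1 v] e by simp
qed

text \<open>A vector \<open>u\<close> in the kernel of the fibre Hessian of \<open>f(K, H)\<close> has components proportional to the
  radial vectors of the two factors, because by homogeneity the differential of \<open>K\<close> is the fibre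
  Hessian of \<open>K\<close> applied to the radial vector. The coefficients are governed by the numbers \<open>a\<close>
  and \<open>b\<close> below, for which one obtains a linear system of two equations. Using the homogeneity of \<open>f\<close>,
  its determinant is \<open>f\<^sub>s f\<^sub>t - 2 f f\<^sub>s\<^sub>t\<close>, the quantity that is nonzero for a product function.\<close>

lemma nondeg_G:
  assumes z: "z \<in> W"
  shows "fibre_nondegenerate G z"
  unfolding fibre_nondegenerate_def
proof (intro allI impI)
  fix u assume u: "\<forall>w. dird (0, u) (dird (0, w) G) z = 0"
  note z12 = W_D[OF z]
  let ?x = "energies z" and ?k = "K (proj1 z)" and ?h = "H (proj2 z)"
  have x: "?x \<in> quadrant" by (rule energies_quadrant[OF z])
  note dK = E1.dif[OF z12(1)] E1.dif2[OF z12(1)] and dH = E2.dif[OF z12(2)] E2.dif2[OF z12(2)]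
  define a where "a = dird (0, fst u) K (proj1 z)"
  define b where "b = dird (0, snd u) H (proj2 z)"
  define fs where "fs = dird (1, 0) f ?x"
  define ft where "ft = dird (0, 1) f ?x"
  define fss where "fss = dird (1, 0) (dird (1, 0) f) ?x"
  define fst' where "fst' = dird (1, 0) (dird (0, 1) f) ?x"
  define ftt where "ftt = dird (0, 1) (dird (0, 1) f) ?x"
  have fts: "dird (0, 1) (dird (1, 0) f) ?x = fst'"
    unfolding fst'_def by (rule dird_commute[OF open_quadrant x smooth_f])
  have df2: "dird (a, b) (dird (c, d) f) ?x = c * (a * fss + b * fst') + d * (a * fst' + b * ftt)" for c d
  proof -
    have "dird (a, b) (dird (c, d) f) ?x = dird (c, d) (dird (a, b) f) ?x"
      by (rule dird_commute[OF open_quadrant x smooth_f])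
    also have "\<dots> = c * dird (1, 0) (dird (a, b) f) ?x + d * dird (0, 1) (dird (a, b) f) ?x"
      by (rule dird_f_pair(2)[OF x])
    also have "dird (1, 0) (dird (a, b) f) ?x = dird (a, b) (dird (1, 0) f) ?x"
      by (rule dird_commute[OF open_quadrant x smooth_f])
    also have "dird (0, 1) (dird (a, b) f) ?x = dird (a, b) (dird (0, 1) f) ?x"
      by (rule dird_commute[OF open_quadrant x smooth_f])
    finally show ?thesis
      by (simp only: dird_f_pair(2)[OF x, of a b] fss_def[symmetric] fst'_def[symmetric] ftt_def[symmetric] fts)
  qed
  have xe: "?x = (?k, ?h)" by (simp add: energies_def)
  have h1: "?k * fs + ?h * ft = f ?x"
    using euler_f(1)[OF x] unfolding fs_def ft_def by (metis dird_f_pair(1)[OF x] xe)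
  have "dird (1, 0) (dird (?k, ?h) f) ?x = 0" "dird (0, 1) (dird (?k, ?h) f) ?x = 0"
    using euler_f(2)[OF x] by (simp_all flip: xe)
  then have "dird (?k, ?h) (dird (1, 0) f) ?x = 0" "dird (?k, ?h) (dird (0, 1) f) ?x = 0"
    by (simp_all only: dird_commute[OF open_quadrant x smooth_f, of "(?k, ?h)"])
  then have h2: "?k * fss + ?h * fst' = 0" "?k * fst' + ?h * ftt = 0"
    by (simp_all only: dird_f_pair(2)[OF x, of ?k ?h] fss_def fst'_def ftt_def fts)
  have nz: "fs \<noteq> 0" "ft \<noteq> 0" "fs * ft - 2 * f ?x * fst' \<noteq> 0"
    using bspec[OF f_partials_nonzero x] bspec[OF f_determinant_nonzero x]
    by (simp_all add: fs_def ft_def fst'_def)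
  let ?c1 = "a * fss + b * fst'" and ?c2 = "a * fst' + b * ftt"
  \<comment> \<open>Testing against vectors \<open>(w, 0)\<close> and \<open>(0, w)\<close> yields one condition in each factor.\<close>
  have "dird (0, fs *\<^sub>R fst u + ?c1 *\<^sub>R snd (proj1 z)) (dird (0, w) K) (proj1 z) = 0" for w
  proof -
    have "(0 :: 'd, fs *\<^sub>R fst u + ?c1 *\<^sub>R snd (proj1 z)) = fs *\<^sub>R (0, fst u) + ?c1 *\<^sub>R (0, snd (proj1 z))" by simp
    then have "dird (0, fs *\<^sub>R fst u + ?c1 *\<^sub>R snd (proj1 z)) (dird (0, w) K) (proj1 z)
        = fs * dird (0, fst u) (dird (0, w) K) (proj1 z) + ?c1 * dird (0, w) K (proj1 z)"
      by (simp only: dird_add_dir[OF dK(2)] dird_scaleR_dir[OF dK(2)] E1.euler_fibre_hessian[OF z12(1)]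
        real_scaleR_def)
    also have "\<dots> = dird (0, u) (dird (0, (w, 0)) G) z"
    proof -
      have p: "proj1 (0, u) = (0, fst u)" "proj2 (0, u) = (0, snd u)" 
        "proj1 (0, (w, 0)) = (0, w)" "proj2 (0, (w, 0)) = 0" by (simp_all add: zero_prod_def)
      have "dird (0, snd u) (dird 0 H) (proj2 z) = 0"
        by (subst dird_commute[OF E2.open_W z12(2) E2.smooth_K]) (rule dird_zero_dir[OF dH(2)])
      then show ?thesis
        unfolding dird_dird_G[OF z] p dird_zero_dir[OF dH(1)] a_def[symmetric] b_def[symmetric] df2
        by (subst dird_f_pair(1)[OF x]) (simp add: fs_def[symmetric] ft_def[symmetric])
    qed
    finally show ?thesis using u by simp
  qed
  then have e1: "fs *\<^sub>R fst u + ?c1 *\<^sub>R snd (proj1 z) = 0"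
    using E1.nondeg_K[OF z12(1)] unfolding fibre_nondegenerate_def by blast
  have "dird (0, ft *\<^sub>R snd u + ?c2 *\<^sub>R snd (proj2 z)) (dird (0, w) H) (proj2 z) = 0" for w
  proof -
    have "(0 :: 'e, ft *\<^sub>R snd u + ?c2 *\<^sub>R snd (proj2 z)) = ft *\<^sub>R (0, snd u) + ?c2 *\<^sub>R (0, snd (proj2 z))" by simp
    then have "dird (0, ft *\<^sub>R snd u + ?c2 *\<^sub>R snd (proj2 z)) (dird (0, w) H) (proj2 z)
        = ft * dird (0, snd u) (dird (0, w) H) (proj2 z) + ?c2 * dird (0, w) H (proj2 z)"
      by (simp only: dird_add_dir[OF dH(2)] dird_scaleR_dir[OF dH(2)] E2.euler_fibre_hessian[OF z12(2)]
        real_scaleR_def)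
    also have "\<dots> = dird (0, u) (dird (0, (0, w)) G) z"
    proof -
      have p: "proj1 (0, u) = (0, fst u)" "proj2 (0, u) = (0, snd u)" 
        "proj2 (0, (0, w)) = (0, w)" "proj1 (0, (0, w)) = 0" by (simp_all add: zero_prod_def)
      have "dird (0, fst u) (dird 0 K) (proj1 z) = 0"
        by (subst dird_commute[OF E1.open_W z12(1) E1.smooth_K]) (rule dird_zero_dir[OF dK(2)])
      then show ?thesis
        unfolding dird_dird_G[OF z] p dird_zero_dir[OF dK(1)] a_def[symmetric] b_def[symmetric] df2
        by (subst dird_f_pair(1)[OF x]) (simp add: fs_def[symmetric] ft_def[symmetric])
    qed
    finally show ?thesis using u by simp
  qed
  then have e2: "ft *\<^sub>R snd u + ?c2 *\<^sub>R snd (proj2 z) = 0"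
    using E2.nondeg_K[OF z12(2)] unfolding fibre_nondegenerate_def by blast
  have "dird (fs *\<^sub>R (0, fst u) + ?c1 *\<^sub>R (0, snd (proj1 z))) K (proj1 z) = 0"
    using e1 dird_zero_dir[OF dK(1)] by (simp add: zero_prod_def)
  then have A: "fs * a + ?c1 * (2 * ?k) = 0"
    by (simp only: dird_add_dir[OF dK(1)] dird_scaleR_dir[OF dK(1)] E1.euler_K[OF z12(1)] real_scaleR_def a_def)
  have "dird (ft *\<^sub>R (0, snd u) + ?c2 *\<^sub>R (0, snd (proj2 z))) H (proj2 z) = 0"
    using e2 dird_zero_dir[OF dH(1)] by (simp add: zero_prod_def)
  then have B: "ft * b + ?c2 * (2 * ?h) = 0"
    by (simp only: dird_add_dir[OF dH(1)] dird_scaleR_dir[OF dH(1)] E2.euler_K[OF z12(2)] real_scaleR_def b_def)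
  \<comment> \<open>The pure second derivatives of \<open>f\<close> are eliminated with Euler's relations, leaving only the
    mixed one.\<close>
  have A': "(fs - 2 * ?h * fst') * a + 2 * ?k * fst' * b = 0"
    using A h2(1) by algebra
  have B': "(ft - 2 * ?k * fst') * b + 2 * ?h * fst' * a = 0"
    using B h2(2) by algebra
  \<comment> \<open>Cramer's rule; \<open>h1\<close> turns the determinant into the expression with \<open>f\<close>.\<close>
  have "(fs * ft - 2 * f ?x * fst') * a = 0" "(fs * ft - 2 * f ?x * fst') * b = 0"
    using A' B' h1 by algebra+
  then have ab: "a = 0" "b = 0" using nz(3) by auto
  then show "u = 0"
    using e1 e2 nz by (simp add: prod_eq_iff)
qed

context
  fixes Q1 :: "'d \<times> 'd \<Rightarrow> 'd" and Q2 :: "'e \<times> 'e \<Rightarrow> 'e"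
  assumes smooth_Q1: "smooth_on W1 Q1" and smooth_Q2: "smooth_on W2 Q2"
begin

definition Q where "Q z = (Q1 (proj1 z), Q2 (proj2 z))"

lemma smooth_Q: "smooth_on W Q"
  unfolding Q_def[abs_def] by (intro smooth_on_Pair open_W smooth_proj1 smooth_proj2 smooth_Q1 smooth_Q2)

lemma vertical_div_Q:
  assumes "z \<in> W"
  shows "vertical_div Q z = vertical_div Q1 (proj1 z) + vertical_div Q2 (proj2 z)"
  unfolding vertical_div_def Q_def[abs_def] dird_pair_proj[OF assms smooth_Q1 smooth_Q2]
  by (simp add: sum_Basis_prod)

text \<open>The spray is a product, so its divergence is a sum of functions of the two factors and the fibre
  Hessian is block diagonal. Zero vectors as one of the two components isolate the blocks.\<close>

lemma fibre_affine_product: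
  assumes z: "z \<in> W"
  shows "fibre_affine_at (vertical_div Q) z \<longleftrightarrow>
    fibre_affine_at (vertical_div Q1) (proj1 z) \<and> fibre_affine_at (vertical_div Q2) (proj2 z)"
proof -
  let ?V1 = "vertical_div Q1" and ?V2 = "vertical_div Q2"
  note V1 = smooth_on_vertical_div[OF E1.open_W smooth_Q1]
    and V2 = smooth_on_vertical_div[OF E2.open_W smooth_Q2]
  have add: "dird v F z = dird (proj1 v) F1 (proj1 z) + dird (proj2 v) F2 (proj2 z)"
    if "z \<in> W" "smooth_on W1 F1" "smooth_on W2 F2" "\<And>z. z \<in> W \<Longrightarrow> F z = F1 (proj1 z) + F2 (proj2 z)"
    for z v and F F1 F2 :: "_ \<Rightarrow> real"
  proof -
    have "dird v F z = dird v (\<lambda>z. F1 (proj1 z) + F2 (proj2 z)) z"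
      by (rule dird_cong_open[OF open_W that(1,4)])
    then show ?thesis using that(1-3)
      by (simp add: dird_add smooth_on_differentiable[OF smooth_proj1] smooth_on_differentiable[OF smooth_proj2]
        dird_compose_linear[OF bounded_linear_proj1] dird_compose_linear[OF bounded_linear_proj2]
        smooth_on_differentiable W_D)
  qed
  have d: "dird (0, u) (dird (0, w) (vertical_div Q)) z =
      dird (0, fst u) (dird (0, fst w) ?V1) (proj1 z) + dird (0, snd u) (dird (0, snd w) ?V2) (proj2 z)" for u w
  proof -
    have "dird (0, u) (dird (0, w) (vertical_div Q)) z =
      dird (proj1 (0, u)) (dird (proj1 (0, w)) ?V1) (proj1 z) + dird (proj2 (0, u)) (dird (proj2 (0, w)) ?V2) (proj2 z)"
      by (rule add[OF z smooth_on_dird[OF V1] smooth_on_dird[OF V2]])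
        (rule add[OF _ V1 V2], simp_all add: vertical_div_Q)
    then show ?thesis by simp
  qed
  have z1: "dird (0, 0) (dird v ?V1) (proj1 z) = 0" and z2: "dird (0, 0) (dird v' ?V2) (proj2 z) = 0" for v v'
    using dird_zero_dir[OF smooth_on_differentiable[OF smooth_on_dird[OF V1] W_D(1)[OF z]]]
      dird_zero_dir[OF smooth_on_differentiable[OF smooth_on_dird[OF V2] W_D(2)[OF z]]]
    by (simp_all add: zero_prod_def)
  show ?thesis
  proof
    assume *: "fibre_affine_at (vertical_div Q) z"
    have "dird (0, u) (dird (0, w) ?V1) (proj1 z) = 0" for u w
      using *[unfolded fibre_affine_at_def d, rule_format, of "(u, 0)" "(w, 0)"] by (simp add: z2)
    moreover have "dird (0, u) (dird (0, w) ?V2) (proj2 z) = 0" for u w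
      using *[unfolded fibre_affine_at_def d, rule_format, of "(0, u)" "(0, w)"] by (simp add: z1)
    ultimately show "fibre_affine_at ?V1 (proj1 z) \<and> fibre_affine_at ?V2 (proj2 z)"
      by (simp add: fibre_affine_at_def)
  qed (simp add: fibre_affine_at_def d)
qed

end

end

section \<open>Charts and tangent vectors\<close>

lemma chart_onD:
  assumes "chart_on X c"
  shows "openin X (cdom c)" "open (crange c)" "inj_on (cmap c) (cdom c)" "cdom c \<subseteq> topspace X"
proof -
  show o: "openin X (cdom c)" "open (crange c)" using assms by (auto simp: chart_on_def)
  show s: "cdom c \<subseteq> topspace X" using o(1) by (rule openin_subset)
  show "inj_on (cmap c) (cdom c)"
    using homeomorphic_imp_injective_map[of "subtopology X (cdom c)"] assms s
    by (auto simp: chart_on_def topspace_subtopology Int_absorb1)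
qed

lemma cinv_cmap: "chart_on X c \<Longrightarrow> p \<in> cdom c \<Longrightarrow> cinv c (cmap c p) = p"
  by (simp add: cinv_def chart_onD)

lemma cinv_crange: "x \<in> crange c \<Longrightarrow> cinv c x \<in> cdom c" "x \<in> crange c \<Longrightarrow> cmap c (cinv c x) = x"
  by (auto simp: cinv_def crange_def inv_into_into f_inv_into_f)

lemma cmap_crange: "p \<in> cdom c \<Longrightarrow> cmap c p \<in> crange c"
  by (simp add: crange_def)

lemma open_chart_image:
  assumes c: "chart_on X c" and U: "openin X U"
  shows "open (cmap c ` (cdom c \<inter> U))"
proof -
  have "open_map (subtopology X (cdom c)) (top_of_set (crange c)) (cmap c)"
    using c by (simp add: chart_on_def homeomorphic_imp_open_map)
  moreover have "openin (subtopology X (cdom c)) (cdom c \<inter> U)"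
    using U by (simp add: openin_subtopology_Int2)
  ultimately have "openin (top_of_set (crange c)) (cmap c ` (cdom c \<inter> U))"
    by (simp add: open_map_def)
  then show ?thesis
    using chart_onD(2)[OF c] by (simp add: openin_open_eq)
qed

text \<open>The charts of a product manifold are specified by their compatibility with product charts. What
  tangent vectors require is the chain rule between any two of its charts, and for that the
  differentiability of the transition maps is the relevant property.\<close>

definition diff_atlas :: "'a topology \<Rightarrow> ('a, 'n::finite) chart set \<Rightarrow> bool"
  where "diff_atlas X A \<longleftrightarrow> (\<forall>c\<in>A. chart_on X c) \<and>
    (\<forall>c\<in>A. \<forall>d\<in>A. \<forall>p\<in>cdom c \<inter> cdom d. (cmap d \<circ> cinv c) differentiable (at (cmap c p)))"

text \<open>Near \<open>p\<close> the coordinate expression of \<open>g\<close> in the chart \<open>c\<close> is the one in the chart \<open>d\<close> after the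
  transition map; this chain rule underlies all statements about components of tangent vectors.\<close>

lemma differentiable_through_chart:
  assumes c: "chart_on X c" and d: "chart_on X d" and p: "p \<in> cdom c" "p \<in> cdom d"
    and 1: "(cmap d \<circ> cinv c) differentiable (at (cmap c p))"
    and 2: "(g \<circ> cinv d) differentiable (at (cmap d p))"
  shows "(g \<circ> cinv c) differentiable (at (cmap c p))"
    and "dird (dird y (cmap d \<circ> cinv c) (cmap c p)) (g \<circ> cinv d) (cmap d p) = dird y (g \<circ> cinv c) (cmap c p)"
proof -
  let ?U = "cmap c ` (cdom c \<inter> cdom d)"
  let ?h = "\<lambda>x. (g \<circ> cinv d) ((cmap d \<circ> cinv c) x)"
  have U: "open ?U" "cmap c p \<in> ?U"
    using open_chart_image[OF c chart_onD(1)[OF d]] p by auto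
  have eq: "?h x = (g \<circ> cinv c) x" if "x \<in> ?U" for x
    using that by (auto simp: cinv_cmap[OF c] cinv_cmap[OF d])
  have 2: "(g \<circ> cinv d) differentiable (at ((cmap d \<circ> cinv c) (cmap c p)))"
    using 2 by (simp add: cinv_cmap[OF c p(1)])
  show "(g \<circ> cinv c) differentiable (at (cmap c p))"
    by (rule differentiable_cong_open[OF U eq differentiable_compose_at[OF 1 2]])
  have "dird y (g \<circ> cinv c) (cmap c p) = dird y ?h (cmap c p)"
    by (rule dird_cong_open[OF U eq[symmetric]])
  then show "dird (dird y (cmap d \<circ> cinv c) (cmap c p)) (g \<circ> cinv d) (cmap d p) = dird y (g \<circ> cinv c) (cmap c p)"
    unfolding dird_compose[OF 1 2] by (simp only: o_apply cinv_cmap[OF c p(1)])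
qed

lemma diff_atlas_smooth_structure:
  assumes A: "\<And>d. d \<in> A \<Longrightarrow> chart_on X d" and cover: "topspace X \<subseteq> (\<Union>d\<in>A. cdom d)"
  shows "diff_atlas X (smooth_structure X A)"
  unfolding diff_atlas_def
proof (intro conjI ballI)
  fix c e p assume c: "c \<in> smooth_structure X A" and e: "e \<in> smooth_structure X A" and p: "p \<in> cdom c \<inter> cdom e"
  have cc: "chart_on X c" and ce: "chart_on X e" using c e by (auto simp: smooth_structure_def)
  obtain d where d: "d \<in> A" "p \<in> cdom d" using p cover chart_onD(4)[OF cc] by blast
  have "smooth_on (cmap c ` (cdom c \<inter> cdom d)) (cmap d \<circ> cinv c)"
    "smooth_on (cmap d ` (cdom e \<inter> cdom d)) (cmap e \<circ> cinv d)"
    using c e d by (auto simp: smooth_structure_def compatible_def)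
  then have "(cmap d \<circ> cinv c) differentiable (at (cmap c p))" "(cmap e \<circ> cinv d) differentiable (at (cmap d p))"
    using p d by (auto intro: smooth_on_differentiable)
  then show "(cmap e \<circ> cinv c) differentiable (at (cmap c p))"
    using differentiable_through_chart(1)[OF cc A[OF d(1)]] p d(2) by blast
qed (auto simp: smooth_structure_def)

lemma smooth_manifold_diff_atlas:
  assumes "smooth_manifold X A"
  shows "diff_atlas X A"
proof -
  have eq: "smooth_structure X A = A" and cover: "topspace X = (\<Union>c\<in>A. cdom c)"
    using assms by (auto simp: smooth_manifold_def)
  have "chart_on X d" if "d \<in> A" for d
    using that eq by (auto simp: smooth_structure_def)
  then show ?thesis
    using diff_atlas_smooth_structure[of A X] cover eq by simp
qed

lemma diff_atlasD:
  assumes "diff_atlas X A" "c \<in> A"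
  shows "chart_on X c"
    and "d \<in> A \<Longrightarrow> p \<in> cdom c \<Longrightarrow> p \<in> cdom d \<Longrightarrow> (cmap d \<circ> cinv c) differentiable (at (cmap c p))"
  using assms by (auto simp: diff_atlas_def)

lemma dird_own_chart:
  assumes "chart_on X c" "x \<in> crange c"
  shows "dird y (cmap c \<circ> cinv c) x = y"
proof -
  have "dird y (cmap c \<circ> cinv c) x = dird y (\<lambda>x. x) x"
    by (rule dird_cong_open[OF chart_onD(2)[OF assms(1)] assms(2)]) (simp add: cinv_crange)
  then show ?thesis by (simp add: dird_bounded_linear[OF bounded_linear_ident])
qed

lemma tangent_bundleI:
  assumes "p \<in> topspace X" "\<And>c. c \<notin> charts_at A p \<Longrightarrow> V c = 0"
    and "\<And>c d. c \<in> charts_at A p \<Longrightarrow> d \<in> charts_at A p \<Longrightarrow>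
      V d = dird (V c) (cmap d \<circ> cinv c) (cmap c p)"
  shows "(p, V) \<in> tangent_bundle X A"
  using assms unfolding tangent_bundle_def by blast

context
  fixes X :: "'a topology" and A :: "('a, 'n::finite) chart set" and c x
  assumes A: "diff_atlas X A" and c: "c \<in> A" and x: "x \<in> crange c"
begin

lemma chart_at_base: "c \<in> charts_at A (cinv c x)"
  using c x by (simp add: charts_at_def cinv_crange)

lemma transition_differentiable:
  assumes "d \<in> charts_at A (cinv c x)"
  shows "(cmap d \<circ> cinv c) differentiable (at x)"
  using diff_atlasD(2)[OF A c, of d "cinv c x"] assms x by (simp add: charts_at_def cinv_crange)

lemma tvec_of_in_tangent_bundle: "tvec_of A c (x, y) \<in> tangent_bundle X A"
proof -
  let ?p = "cinv c x"
  have "dird y (cmap e \<circ> cinv c) x = dird (dird y (cmap d \<circ> cinv c) x) (cmap e \<circ> cinv d) (cmap d ?p)"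
    if "d \<in> charts_at A ?p" "e \<in> charts_at A ?p" for d e
  proof -
    have de: "d \<in> A" "?p \<in> cdom d" "e \<in> A" "?p \<in> cdom e"
      using that by (auto simp: charts_at_def)
    have 1: "(cmap d \<circ> cinv c) differentiable (at (cmap c ?p))"
      using transition_differentiable[OF that(1)] by (simp add: cinv_crange[OF x])
    show ?thesis
      using differentiable_through_chart(2)[OF diff_atlasD(1)[OF A c] diff_atlasD(1)[OF A de(1)]
        cinv_crange(1)[OF x] de(2) 1 diff_atlasD(2)[OF A de(1,3,2,4)], of y]
      unfolding cinv_crange(2)[OF x] by (rule sym)
  qed
  note chain = this
  have "?p \<in> topspace X"
    using chart_onD(4)[OF diff_atlasD(1)[OF A c]] cinv_crange(1)[OF x] by auto
  have trans: "(if e \<in> charts_at A ?p then dird y (cmap e \<circ> cinv c) x else 0)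
      = dird (if d \<in> charts_at A ?p then dird y (cmap d \<circ> cinv c) x else 0) (cmap e \<circ> cinv d) (cmap d ?p)"
    if "d \<in> charts_at A ?p" "e \<in> charts_at A ?p" for d e
    using chain[OF that] that by presburger
  show ?thesis
    unfolding tvec_of_def case_prod_conv
    by (rule tangent_bundleI[OF \<open>?p \<in> topspace X\<close> _ trans]) simp_all
qed

lemma tzero_tvec_of: "tzero (tvec_of A c (x, y)) \<longleftrightarrow> y = 0"
proof
  assume "tzero (tvec_of A c (x, y))"
  then have "snd (tvec_of A c (x, y)) c = 0" by (simp add: tzero_def)
  then show "y = 0"
    using chart_at_base by (simp add: tvec_of_def dird_own_chart[OF diff_atlasD(1)[OF A c] x])
next
  assume "y = 0"
  then show "tzero (tvec_of A c (x, y))"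
    by (simp add: fun_eq_iff tzero_def tvec_of_def dird_zero_dir[OF transition_differentiable]
      del: split_paired_All)
qed

lemma tscale_tvec_of: "tscale r (tvec_of A c (x, y)) = tvec_of A c (x, r *\<^sub>R y)"
  by (simp add: fun_eq_iff tscale_def tvec_of_def dird_scaleR_dir[OF transition_differentiable]
    del: split_paired_All)

lemma tvec_of_in_slit: "y \<noteq> 0 \<Longrightarrow> tvec_of A c (x, y) \<in> slit_tangent_bundle X A"
  by (simp add: slit_tangent_bundle_def tvec_of_in_tangent_bundle tzero_tvec_of)

text \<open>The differential is defined through a chart picked by choice. By the chain rule any chart
  gives the same result, in particular the chart in which the tangent vector was given.\<close>

lemma tmap_tvec_of:
  fixes Y :: "'b topology" and B :: "('b, 'm::finite) chart set" and h :: "'a \<Rightarrow> 'b"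
  assumes B: "diff_atlas Y B" and h: "continuous_map X Y h"
    and diff: "\<And>c d p. c \<in> A \<Longrightarrow> d \<in> B \<Longrightarrow> p \<in> cdom c \<Longrightarrow> h p \<in> cdom d \<Longrightarrow>
      (cmap d \<circ> h \<circ> cinv c) differentiable (at (cmap c p))"
    and d: "d \<in> charts_at B (h (cinv c x))"
  shows "tmap A B h (tvec_of A c (x, y)) =
    tvec_of B d ((cmap d \<circ> h \<circ> cinv c) x, dird y (cmap d \<circ> h \<circ> cinv c) x)"
proof -
  let ?p = "cinv c x" and ?\<phi> = "cmap d \<circ> h \<circ> cinv c"
  define c' where "c' = (SOME c. c \<in> charts_at A ?p)"
  have c': "c' \<in> charts_at A ?p"
    unfolding c'_def by (rule someI_ex) (use chart_at_base in blast)
  have cc: "chart_on X c" "chart_on X c'" using diff_atlasD(1)[OF A] c c' by (auto simp: charts_at_def)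
  have px: "cmap c ?p = x" "?p \<in> cdom c" using cinv_crange[OF x] by auto
  have dd: "d \<in> B" "h ?p \<in> cdom d" "chart_on Y d"
    using d diff_atlasD(1)[OF B] by (auto simp: charts_at_def)
  have via_c': "dird (dird y (cmap c' \<circ> cinv c) x) (cmap e \<circ> h \<circ> cinv c') (cmap c' ?p)
      = dird y (cmap e \<circ> h \<circ> cinv c) x" if "e \<in> charts_at B (h ?p)" for e
  proof -
    have e: "e \<in> B" "h ?p \<in> cdom e" and p': "c' \<in> A" "?p \<in> cdom c'"
      using that c' by (auto simp: charts_at_def)
    have 1: "(cmap c' \<circ> cinv c) differentiable (at (cmap c ?p))"
      using transition_differentiable[OF c'] by (simp add: px)
    show ?thesis
      using differentiable_through_chart(2)[OF cc px(2) p'(2) 1 diff[OF p'(1) e(1) p'(2) e(2)], of y]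
      unfolding px(1) .
  qed
  have via_d: "dird y (cmap e \<circ> h \<circ> cinv c) x = dird (dird y ?\<phi> x) (cmap e \<circ> cinv d) (?\<phi> x)"
    if e: "e \<in> charts_at B (h ?p)" for e
  proof -
    let ?U = "cmap c ` (cdom c \<inter> {q \<in> topspace X. h q \<in> cdom d})"
    have U: "open ?U" "x \<in> ?U"
      using open_chart_image[OF cc(1) openin_continuous_map_preimage[OF h chart_onD(1)[OF dd(3)]]]
        px dd(2) chart_onD(4)[OF cc(1)] by (auto simp: image_iff intro!: bexI[of _ ?p])
    have "dird y (cmap e \<circ> h \<circ> cinv c) x = dird y (\<lambda>x. (cmap e \<circ> cinv d) (?\<phi> x)) x"
      by (rule dird_cong_open[OF U]) (auto simp: cinv_cmap[OF cc(1)] cinv_cmap[OF dd(3)])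
    also have "\<dots> = dird (dird y ?\<phi> x) (cmap e \<circ> cinv d) (?\<phi> x)"
    proof (rule dird_compose)
      show "?\<phi> differentiable (at x)"
        using diff[OF c dd(1) px(2) dd(2)] unfolding px(1) .
      show "(cmap e \<circ> cinv d) differentiable (at (?\<phi> x))"
        using diff_atlasD(2)[OF B dd(1), of e "h ?p"] e dd(2) by (simp add: charts_at_def)
    qed
    finally show ?thesis .
  qed
  have base: "cinv d (?\<phi> x) = h ?p"
    by (simp add: cinv_cmap[OF dd(3,2)])
  have "(if e \<in> charts_at B (h ?p)
      then dird (if c' \<in> charts_at A ?p then dird y (cmap c' \<circ> cinv c) x else 0) (cmap e \<circ> h \<circ> cinv c') (cmap c' ?p)
      else 0)
    = (if e \<in> charts_at B (h ?p) then dird (dird y ?\<phi> x) (cmap e \<circ> cinv d) (?\<phi> x) else 0)" for e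
    using c' via_c'[of e] via_d[of e] by presburger
  then show ?thesis
    unfolding tmap_def tvec_of_def case_prod_conv c'_def[symmetric] base Let_def by presburger
qed

end

section \<open>Finsler energies\<close>

text \<open>Positivity and homogeneity of \<open>F\<close> are statements about tangent vectors. They become statements
  about the coordinate function since all pairs \<open>(x, y)\<close> over the chart represent tangent vectors and
  scaling acts on \<open>y\<close>.\<close>

lemma finsler_homogeneous_energy:
  fixes A :: "('a, 'n::finite) chart set"
  assumes M: "smooth_manifold X A" and F: "finsler_metric X A F" and c: "c \<in> A"
  shows "homogeneous_energy (crange c \<times> (- {0})) (energy A F c)"
proof
  note A = smooth_manifold_diff_atlas[OF M]
  let ?W = "crange c \<times> (- {0 :: real ^ 'n})"
  show open_W: "open ?W"
    using chart_onD(2)[OF diff_atlasD(1)[OF A c]] by (intro open_Times open_Compl closed_singleton)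
  show smooth: "smooth_on ?W (energy A F c)"
    using F c by (simp add: finsler_metric_def)
  show "0 < energy A F c z" if z: "z \<in> ?W" for z
  proof -
    have "tvec_of A c z \<in> slit_tangent_bundle X A"
      using z tvec_of_in_slit[OF A c] by (cases z) auto
    then have "0 < F (tvec_of A c z)" using F unfolding finsler_metric_def by blast
    then show ?thesis by (simp add: energy_def)
  qed
  show "energy A F c (x, r *\<^sub>R y) = r\<^sup>2 * energy A F c (x, y)" if "(x, y) \<in> ?W" for x y r
  proof -
    have x: "x \<in> crange c" using that by simp
    have "F (tscale r (tvec_of A c (x, y))) = \<bar>r\<bar> * F (tvec_of A c (x, y))"
      using F tvec_of_in_tangent_bundle[OF A c x] unfolding finsler_metric_def by blast
    then show ?thesis
      by (simp add: energy_def tscale_tvec_of[OF A c x] power_mult_distrib)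
  qed
  show "fibre_nondegenerate (energy A F c) z" if z: "z \<in> ?W" for z
  proof (rule fibre_nondegenerate_if_hess_pos[OF open_W z smooth])
    show "0 < v \<bullet> (hess (energy A F c) z *v v)" if "v \<noteq> 0" for v
      using F c z that unfolding finsler_metric_def by (cases z) auto
  qed
qed

section \<open>Product charts\<close>

definition vfst :: "real ^ ('m::finite + 'n::finite) \<Rightarrow> real ^ 'm"
  where "vfst u = (\<chi> j. u $ Inl j)"

definition vsnd :: "real ^ ('m::finite + 'n::finite) \<Rightarrow> real ^ 'n"
  where "vsnd u = (\<chi> k. u $ Inr k)"

lemma vjoin_simps [simp]: "vfst (vjoin u v) = u" "vsnd (vjoin u v) = v" "vjoin (vfst w) (vsnd w) = w"
  by (auto simp: vfst_def vsnd_def vjoin_def vec_eq_iff split: sum.split)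

lemma vjoin_eq_iff: "vjoin u v = vjoin u' v' \<longleftrightarrow> u = u' \<and> v = v'"
  by (metis vjoin_simps(1,2))

lemma bounded_linear_vfst: "bounded_linear vfst"
  by (simp add: linear_conv_bounded_linear[symmetric] linear_iff vfst_def vec_eq_iff)

lemma bounded_linear_vsnd: "bounded_linear vsnd"
  by (simp add: linear_conv_bounded_linear[symmetric] linear_iff vsnd_def vec_eq_iff)

lemma bounded_linear_vjoin:
  "bounded_linear (\<lambda>p :: (real ^ 'm::finite) \<times> (real ^ 'n::finite). vjoin (fst p) (snd p))"
  by (simp add: linear_conv_bounded_linear[symmetric] linear_iff vjoin_def vec_eq_iff split: sum.split)

lemma prod_chart_simps [simp]:
  "cdom (prod_chart a b) = cdom a \<times> cdom b"
  "cmap (prod_chart a b) p = vjoin (cmap a (fst p)) (cmap b (snd p))"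
  by (simp_all add: prod_chart_def case_prod_unfold)

lemma crange_prod_chart: "crange (prod_chart a b) = {u. vfst u \<in> crange a \<and> vsnd u \<in> crange b}"
proof (intro set_eqI iffI)
  fix u assume "u \<in> {u. vfst u \<in> crange a \<and> vsnd u \<in> crange b}"
  then obtain p q where "p \<in> cdom a" "q \<in> cdom b" "vfst u = cmap a p" "vsnd u = cmap b q"
    by (auto simp: crange_def)
  then have "u = cmap (prod_chart a b) (p, q)" "(p, q) \<in> cdom (prod_chart a b)"
    by (metis prod_chart_simps(2) fst_conv snd_conv vjoin_simps(3), simp)
  then show "u \<in> crange (prod_chart a b)" unfolding crange_def by blast
qed (auto simp: crange_def)

lemma continuous_map_cinv:
  assumes "chart_on X a"
  shows "continuous_map (top_of_set (crange a)) (subtopology X (cdom a)) (cinv a)"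
proof -
  have t: "topspace (subtopology X (cdom a)) = cdom a"
    using chart_onD(4)[OF assms] by (simp add: topspace_subtopology Int_absorb1)
  obtain g where g: "homeomorphic_maps (subtopology X (cdom a)) (top_of_set (crange a)) (cmap a) g"
    using assms unfolding chart_on_def homeomorphic_map_maps by blast
  have "g x = cinv a x" if "x \<in> crange a" for x
    using g that cinv_crange[of x a] t by (auto simp: homeomorphic_maps_def)
  then show ?thesis
    using g continuous_map_eq[of "top_of_set (crange a)" _ g "cinv a"] by (auto simp: homeomorphic_maps_def)
qed

lemma chart_on_prod_chart:
  assumes a: "chart_on X a" and b: "chart_on Y b"
  shows "chart_on (prod_topology X Y) (prod_chart a b)"
proof -
  let ?c = "prod_chart a b" and ?g = "\<lambda>u. (cinv a (vfst u), cinv b (vsnd u))"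
  let ?S = "subtopology (prod_topology X Y) (cdom ?c)" and ?T = "top_of_set (crange ?c)"
  have dom: "openin (prod_topology X Y) (cdom ?c)"
    using chart_onD(1)[OF a] chart_onD(1)[OF b] by (simp add: openin_prod_Times_iff)
  have "open (vfst -` crange a \<inter> vsnd -` crange b)"
    using chart_onD(2)[OF a] chart_onD(2)[OF b]
    by (intro open_Int open_vimage linear_continuous_on bounded_linear_vfst bounded_linear_vsnd)
  then have ran: "open (crange ?c)"
    by (simp add: crange_prod_chart vimage_def Collect_conj_eq)
  have S: "?S = prod_topology (subtopology X (cdom a)) (subtopology Y (cdom b))"
    by (simp add: subtopology_Times)
  have "continuous_map (subtopology X (cdom a)) (top_of_set (crange a)) (cmap a)"
    "continuous_map (subtopology Y (cdom b)) (top_of_set (crange b)) (cmap b)"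
    using a b by (simp_all add: chart_on_def homeomorphic_imp_continuous_map)
  then have ca: "continuous_map (subtopology X (cdom a)) euclidean (cmap a)"
    and cb: "continuous_map (subtopology Y (cdom b)) euclidean (cmap b)"
    unfolding continuous_map_in_subtopology by blast+
  have "homeomorphic_maps ?S ?T (cmap ?c) ?g"
    unfolding homeomorphic_maps_def
  proof (intro conjI ballI)
    have "continuous_map ?S (prod_topology euclidean euclidean) (\<lambda>p. (cmap a (fst p), cmap b (snd p)))"
      unfolding S
      by (intro continuous_map_pairedI continuous_map_compose[OF continuous_map_fst ca, unfolded o_def]
        continuous_map_compose[OF continuous_map_snd cb, unfolded o_def])
    then have "continuous_map ?S euclidean (\<lambda>p. (cmap a (fst p), cmap b (snd p)))"
      using prod_topology_subtopology_eu[of UNIV UNIV] by simp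
    then have "continuous_map ?S euclidean ((\<lambda>p. vjoin (fst p) (snd p)) \<circ> (\<lambda>p. (cmap a (fst p), cmap b (snd p))))"
      by (rule continuous_map_compose) (simp add: linear_continuous_on[OF bounded_linear_vjoin])
    then have "continuous_map ?S euclidean (cmap ?c)"
      by (simp add: o_def prod_chart_def case_prod_unfold)
    then show "continuous_map ?S ?T (cmap ?c)"
      by (auto simp: continuous_map_in_subtopology crange_def topspace_subtopology)
    have "continuous_map ?T (top_of_set (crange a)) vfst" "continuous_map ?T (top_of_set (crange b)) vsnd"
      by (auto simp: crange_prod_chart linear_continuous_on bounded_linear_vfst bounded_linear_vsnd)
    from continuous_map_pairedI[OF continuous_map_compose[OF this(1) continuous_map_cinv[OF a]]
        continuous_map_compose[OF this(2) continuous_map_cinv[OF b]]]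
    show "continuous_map ?T ?S ?g"
      unfolding S by (simp add: o_def)
    show "?g (cmap ?c p) = p" if "p \<in> topspace ?S" for p
      using that by (auto simp: cinv_cmap[OF a] cinv_cmap[OF b] topspace_subtopology)
    show "cmap ?c (?g u) = u" if "u \<in> topspace ?T" for u
      using that by (auto simp: crange_prod_chart cinv_crange)
  qed
  then show ?thesis
    using dom ran homeomorphic_map_maps unfolding chart_on_def by blast
qed

lemma cinv_prod_chart:
  assumes "chart_on X a" "chart_on Y b" "vfst u \<in> crange a" "vsnd u \<in> crange b"
  shows "cinv (prod_chart a b) u = (cinv a (vfst u), cinv b (vsnd u))"
  using cinv_cmap[OF chart_on_prod_chart[OF assms(1,2)], of "(cinv a (vfst u), cinv b (vsnd u))"]
    assms(3,4) by (simp add: cinv_crange)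

lemma transition_prod_chart:
  assumes a: "chart_on X a" "chart_on X a'" "compatible a a'"
    and b: "chart_on Y b" "chart_on Y b'" "compatible b b'"
  shows "smooth_on (cmap (prod_chart a b) ` (cdom (prod_chart a b) \<inter> cdom (prod_chart a' b')))
    (cmap (prod_chart a' b') \<circ> cinv (prod_chart a b))"
proof -
  let ?Sa = "cmap a ` (cdom a \<inter> cdom a')" and ?Sb = "cmap b ` (cdom b \<inter> cdom b')"
  let ?S = "cmap (prod_chart a b) ` (cdom (prod_chart a b) \<inter> cdom (prod_chart a' b'))"
  have oa: "open ?Sa" and ob: "open ?Sb"
    using open_chart_image[OF a(1) chart_onD(1)[OF a(2)]] open_chart_image[OF b(1) chart_onD(1)[OF b(2)]] by auto
  have o: "open ?S"
    by (rule open_chart_image[OF chart_on_prod_chart[OF a(1) b(1)]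
      chart_onD(1)[OF chart_on_prod_chart[OF a(2) b(2)]]])
  have in_S: "vfst u \<in> ?Sa" "vsnd u \<in> ?Sb" if "u \<in> ?S" for u
    using that by auto
  have ta: "smooth_on ?S (\<lambda>u. (cmap a' \<circ> cinv a) (vfst u))"
    by (rule smooth_on_compose[OF o oa in_S(1) smooth_on_bounded_linear[OF bounded_linear_vfst]
      conjunct1[OF a(3)[unfolded compatible_def]]])
  have tb: "smooth_on ?S (\<lambda>u. (cmap b' \<circ> cinv b) (vsnd u))"
    by (rule smooth_on_compose[OF o ob in_S(2) smooth_on_bounded_linear[OF bounded_linear_vsnd]
      conjunct1[OF b(3)[unfolded compatible_def]]])
  have eq: "cinv (prod_chart a b) u = (cinv a (vfst u), cinv b (vsnd u))" if "u \<in> ?S" for u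
    using in_S[OF that] by (intro cinv_prod_chart[OF a(1) b(1)]) (auto simp: crange_def)
  show ?thesis
    by (rule smooth_on_cong[OF smooth_on_linear_fun[OF bounded_linear_vjoin o smooth_on_Pair[OF o ta tb]] o])
      (simp add: eq)
qed

section \<open>Product manifolds\<close>

text \<open>By the chain rule the derivative of \<open>\<psi>\<close> is inverse to that of \<open>\<phi>\<close> on both sides.\<close>

lemma bij_derivative_of_inverse:
  assumes U: "open U" "x \<in> U" "\<And>x. x \<in> U \<Longrightarrow> \<psi> (\<phi> x) = x"
    and V: "open V" "\<phi> x \<in> V" "\<And>y. y \<in> V \<Longrightarrow> \<phi> (\<psi> y) = y"
    and d: "\<phi> differentiable (at x)" "\<psi> differentiable (at (\<phi> x))"
  shows "bij (\<lambda>v. dird v \<phi> x)"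
proof -
  have "dird (dird v \<phi> x) \<psi> (\<phi> x) = v" for v
  proof -
    have "dird (dird v \<phi> x) \<psi> (\<phi> x) = dird v (\<lambda>x. \<psi> (\<phi> x)) x"
      by (rule dird_compose[OF d, symmetric])
    also have "\<dots> = dird v (\<lambda>x. x) x" by (rule dird_cong_open[OF U])
    finally show ?thesis by (simp add: dird_bounded_linear[OF bounded_linear_ident])
  qed
  moreover have "dird (dird w \<psi> (\<phi> x)) \<phi> x = w" for w
  proof -
    have x: "\<psi> (\<phi> x) = x" by (rule U(3)[OF U(2)])
    have "dird (dird w \<psi> (\<phi> x)) \<phi> x = dird w (\<lambda>y. \<phi> (\<psi> y)) (\<phi> x)"
      using dird_compose[OF d(2), of \<phi> w] d(1) by (simp add: x)
    also have "\<dots> = dird w (\<lambda>y. y) (\<phi> x)" by (rule dird_cong_open[OF V])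
    finally show ?thesis by (simp add: dird_bounded_linear[OF bounded_linear_ident])
  qed
  ultimately show ?thesis by (intro bijI') metis+
qed

text \<open>The setting of the theorem, with the product charts, their transition maps and the differentials of
  the two projections in coordinates.\<close>

locale finsler_product =
  fixes X1 :: "'a topology" and A1 :: "('a, 'm::finite) chart set"
    and F1 :: "('a, 'm) tvec \<Rightarrow> real"
    and X2 :: "'b topology" and A2 :: "('b, 'n::finite) chart set"
    and F2 :: "('b, 'n) tvec \<Rightarrow> real"
    and f :: "real \<times> real \<Rightarrow> real"
  assumes M1: "smooth_manifold X1 A1" and F1: "finsler_metric X1 A1 F1"
    and M2: "smooth_manifold X2 A2" and F2: "finsler_metric X2 A2 F2"
    and f: "product_function f"
begin

abbreviation "X \<equiv> prod_topology X1 X2"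
abbreviation "A \<equiv> prod_structure X1 A1 X2 A2"
abbreviation "F \<equiv> mink_product f X1 A1 F1 X2 A2 F2"

lemma A1: "diff_atlas X1 A1" and A2: "diff_atlas X2 A2"
  using M1 M2 smooth_manifold_diff_atlas by auto

lemma chart1: "a \<in> A1 \<Longrightarrow> chart_on X1 a" and chart2: "b \<in> A2 \<Longrightarrow> chart_on X2 b"
  using A1 A2 by (auto simp: diff_atlas_def)

lemma cover1: "topspace X1 = (\<Union>a\<in>A1. cdom a)" and cover2: "topspace X2 = (\<Union>b\<in>A2. cdom b)"
  using M1 M2 by (auto simp: smooth_manifold_def)

lemma compatible1: "a \<in> A1 \<Longrightarrow> a' \<in> A1 \<Longrightarrow> compatible a a'"
  and compatible2: "b \<in> A2 \<Longrightarrow> b' \<in> A2 \<Longrightarrow> compatible b b'"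
  using M1 M2 by (auto simp: smooth_manifold_def smooth_structure_def)

lemma compatible_prod_chart:
  assumes "a \<in> A1" "a' \<in> A1" "b \<in> A2" "b' \<in> A2"
  shows "compatible (prod_chart a b) (prod_chart a' b')"
  using transition_prod_chart[OF chart1 chart1 compatible1 chart2 chart2 compatible2, of a a' b b']
    transition_prod_chart[OF chart1 chart1 compatible1 chart2 chart2 compatible2, of a' a b' b] assms
  unfolding compatible_def Int_commute[of "cdom (prod_chart a' b')"] by blast

lemma prod_chart_in:
  assumes "a \<in> A1" "b \<in> A2"
  shows "prod_chart a b \<in> A"
  unfolding prod_structure_def smooth_structure_def
  using chart_on_prod_chart[OF chart1 chart2] compatible_prod_chart assms by blast

lemma A: "diff_atlas X A"
  unfolding prod_structure_def
proof (rule diff_atlas_smooth_structure)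
  show "topspace X \<subseteq> (\<Union>d\<in>{prod_chart a b | a b. a \<in> A1 \<and> b \<in> A2}. cdom d)"
  proof
    fix p assume "p \<in> topspace X"
    then obtain a b where ab: "a \<in> A1" "b \<in> A2" "fst p \<in> cdom a" "snd p \<in> cdom b"
      using cover1 cover2 unfolding topspace_prod_topology by (metis UN_E mem_Times_iff)
    then have "p \<in> cdom (prod_chart a b)" by (simp add: mem_Times_iff)
    then show "p \<in> (\<Union>d\<in>{prod_chart a b | a b. a \<in> A1 \<and> b \<in> A2}. cdom d)"
      using ab(1,2) by blast
  qed
qed (use chart_on_prod_chart[OF chart1 chart2] in blast)

lemma chart: "c \<in> A \<Longrightarrow> chart_on X c"
  by (rule diff_atlasD(1)[OF A])

lemma transition_smooth:
  assumes "c \<in> A" "a \<in> A1" "b \<in> A2"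
  shows "smooth_on (cmap c ` (cdom c \<inter> cdom (prod_chart a b))) (cmap (prod_chart a b) \<circ> cinv c)"
    and "smooth_on (cmap (prod_chart a b) ` (cdom c \<inter> cdom (prod_chart a b))) (cmap c \<circ> cinv (prod_chart a b))"
  using assms unfolding prod_structure_def smooth_structure_def compatible_def by blast+

text \<open>The transition from a chart \<open>c\<close> of the product to a product chart, with values in pairs of
  coordinate vectors instead of joined vectors.\<close>

definition split_coords where
  "split_coords c a b x = (cmap a (fst (cinv c x)), cmap b (snd (cinv c x)))"

abbreviation "split_dom c a b \<equiv> cmap c ` (cdom c \<inter> cdom (prod_chart a b))"

lemma open_split_dom: "c \<in> A \<Longrightarrow> a \<in> A1 \<Longrightarrow> b \<in> A2 \<Longrightarrow> open (split_dom c a b)"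
  by (rule open_chart_image[OF chart chart_onD(1)[OF chart_on_prod_chart[OF chart1 chart2]]])

lemma smooth_split_coords:
  assumes "c \<in> A" "a \<in> A1" "b \<in> A2"
  shows "smooth_on (split_dom c a b) (split_coords c a b)"
proof -
  have "split_coords c a b = (\<lambda>x. (vfst ((cmap (prod_chart a b) \<circ> cinv c) x), vsnd ((cmap (prod_chart a b) \<circ> cinv c) x)))"
    by (auto simp: split_coords_def)
  then show ?thesis
    using smooth_on_Pair[OF open_split_dom[OF assms]
      smooth_on_linear_fun[OF bounded_linear_vfst open_split_dom[OF assms] transition_smooth(1)[OF assms]]
      smooth_on_linear_fun[OF bounded_linear_vsnd open_split_dom[OF assms] transition_smooth(1)[OF assms]]]
    by (simp only:)
qed

lemma bij_split_coords:
  assumes cab: "c \<in> A" "a \<in> A1" "b \<in> A2" and x: "x \<in> split_dom c a b"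
  shows "bij (\<lambda>v. dird v (split_coords c a b) x)"
proof (rule bij_derivative_of_inverse[OF open_split_dom[OF cab] x])
  let ?pc = "prod_chart a b" and ?j = "\<lambda>p. vjoin (fst p) (snd p)"
  let ?\<psi> = "\<lambda>p. (cmap c \<circ> cinv ?pc) (?j p)"
  let ?U = "cmap ?pc ` (cdom c \<inter> cdom ?pc)"
  let ?V = "?j -` ?U"
  note pc = chart_on_prod_chart[OF chart1[OF cab(2)] chart2[OF cab(3)]]
  have U: "open ?U"
    using open_chart_image[OF pc chart_onD(1)[OF chart[OF cab(1)]]] by (simp add: Int_commute)
  show V: "open ?V"
    by (rule open_vimage[OF U linear_continuous_on[OF bounded_linear_vjoin]])
  have j: "?j (split_coords c a b x) = cmap ?pc (cinv c x)" for x
    by (simp add: split_coords_def)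
  show "?\<psi> (split_coords c a b x) = x" if "x \<in> split_dom c a b" for x
    using that unfolding j by (auto simp: cinv_cmap[OF pc] cinv_cmap[OF chart[OF cab(1)]] simp del: prod_chart_simps)
  show xV: "split_coords c a b x \<in> ?V"
    using x j by (auto simp: cinv_cmap[OF chart[OF cab(1)]] simp del: prod_chart_simps)
  show "split_coords c a b (?\<psi> p) = p" if "p \<in> ?V" for p
  proof -
    obtain q where q: "q \<in> cdom c" "q \<in> cdom ?pc" "?j p = cmap ?pc q" using \<open>p \<in> ?V\<close> by auto
    then have "?\<psi> p = cmap c q" by (simp add: cinv_cmap[OF pc] del: prod_chart_simps)
    then have "split_coords c a b (?\<psi> p) = (cmap a (fst q), cmap b (snd q))"
      by (simp add: split_coords_def cinv_cmap[OF chart[OF cab(1)] q(1)])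
    also have "\<dots> = p" using q(3) by (simp add: vjoin_eq_iff prod_eq_iff)
    finally show ?thesis .
  qed
  show "split_coords c a b differentiable (at x)"
    by (rule smooth_on_differentiable[OF smooth_split_coords[OF cab] x])
  have "(cmap c \<circ> cinv ?pc) differentiable (at (?j (split_coords c a b x)))"
    using xV by (intro smooth_on_differentiable[OF transition_smooth(2)[OF cab]]) auto
  then show "?\<psi> differentiable (at (split_coords c a b x))"
    by (rule differentiable_compose_at[OF bounded_linear_imp_differentiable[OF bounded_linear_vjoin]])
qed

lemma split_coords_differentiable:
  assumes "c \<in> A" "a \<in> A1" "b \<in> A2" "p \<in> cdom c" "p \<in> cdom (prod_chart a b)"
  shows "split_coords c a b differentiable (at (cmap c p))"
  using assms by (intro smooth_on_differentiable[OF smooth_split_coords]) auto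

lemma tmap_fst:
  assumes cab: "c \<in> A" "a \<in> A1" "b \<in> A2" and x: "x \<in> split_dom c a b"
  shows "tmap A A1 fst (tvec_of A c (x, y)) = tvec_of A1 a (proj1 (tangent_lift (split_coords c a b) (x, y)))"
proof -
  have p: "x \<in> crange c" "cinv c x \<in> cdom (prod_chart a b)"
    using x by (auto simp: crange_def cinv_cmap[OF chart[OF cab(1)]])
  have comp: "cmap a' \<circ> fst \<circ> cinv c' = (\<lambda>x. fst (split_coords c' a' b' x))"
    for c' :: "('a \<times> 'b, 'm + 'n) chart" and a' :: "('a, 'm) chart" and b' :: "('b, 'n) chart"
    by (auto simp: split_coords_def)
  have "(cmap a' \<circ> fst \<circ> cinv c') differentiable (at (cmap c' p))"
    if c': "c' \<in> A" and a': "a' \<in> A1" and p: "p \<in> cdom c'" "fst p \<in> cdom a'" for c' a' p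
  proof -
    obtain b' where b': "b' \<in> A2" "snd p \<in> cdom b'"
      using chart_onD(4)[OF chart[OF c']] p(1) cover2 by fastforce
    have "split_coords c' a' b' differentiable (at (cmap c' p))"
      using c' a' p b' by (intro split_coords_differentiable) (auto simp: mem_Times_iff)
    then show ?thesis
      unfolding comp[of _ _ b'] by (rule differentiable_linear_fun[OF bounded_linear_fst])
  qed
  then have "tmap A A1 fst (tvec_of A c (x, y)) =
      tvec_of A1 a ((cmap a \<circ> fst \<circ> cinv c) x, dird y (cmap a \<circ> fst \<circ> cinv c) x)"
    using p(2) cab(2) by (intro tmap_tvec_of[OF A cab(1) p(1) A1 continuous_map_fst])
      (auto simp: charts_at_def)
  moreover have "split_coords c a b differentiable (at x)"
    by (rule smooth_on_differentiable[OF smooth_split_coords[OF cab] x])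
  ultimately show ?thesis
    by (simp add: comp[of _ _ b] dird_linear_fun[OF bounded_linear_fst] tangent_lift_def)
qed

lemma tmap_snd:
  assumes cab: "c \<in> A" "a \<in> A1" "b \<in> A2" and x: "x \<in> split_dom c a b"
  shows "tmap A A2 snd (tvec_of A c (x, y)) = tvec_of A2 b (proj2 (tangent_lift (split_coords c a b) (x, y)))"
proof -
  have p: "x \<in> crange c" "cinv c x \<in> cdom (prod_chart a b)"
    using x by (auto simp: crange_def cinv_cmap[OF chart[OF cab(1)]])
  have comp: "cmap b' \<circ> snd \<circ> cinv c' = (\<lambda>x. snd (split_coords c' a' b' x))"
    for c' :: "('a \<times> 'b, 'm + 'n) chart" and a' :: "('a, 'm) chart" and b' :: "('b, 'n) chart"
    by (auto simp: split_coords_def)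
  have "(cmap b' \<circ> snd \<circ> cinv c') differentiable (at (cmap c' p))"
    if c': "c' \<in> A" and b': "b' \<in> A2" and p: "p \<in> cdom c'" "snd p \<in> cdom b'" for c' b' p
  proof -
    obtain a' where a': "a' \<in> A1" "fst p \<in> cdom a'"
      using chart_onD(4)[OF chart[OF c']] p(1) cover1 by fastforce
    have "split_coords c' a' b' differentiable (at (cmap c' p))"
      using c' b' p a' by (intro split_coords_differentiable) (auto simp: mem_Times_iff)
    then show ?thesis
      unfolding comp[of _ _ a'] by (rule differentiable_linear_fun[OF bounded_linear_snd])
  qed
  then have "tmap A A2 snd (tvec_of A c (x, y)) =
      tvec_of A2 b ((cmap b \<circ> snd \<circ> cinv c) x, dird y (cmap b \<circ> snd \<circ> cinv c) x)"
    using p(2) cab(3) by (intro tmap_tvec_of[OF A cab(1) p(1) A2 continuous_map_snd])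
      (auto simp: charts_at_def)
  moreover have "split_coords c a b differentiable (at x)"
    by (rule smooth_on_differentiable[OF smooth_split_coords[OF cab] x])
  ultimately show ?thesis
    by (simp add: comp[of _ _ a] dird_linear_fun[OF bounded_linear_snd] tangent_lift_def)
qed

lemma split_coords_crange:
  assumes "c \<in> A" "x \<in> split_dom c a b"
  shows "fst (split_coords c a b x) \<in> crange a" "snd (split_coords c a b x) \<in> crange b"
  using assms by (auto simp: split_coords_def cinv_cmap[OF chart] crange_def)

text \<open>The criterion at a single tangent vector. In the coordinates \<open>split_coords c a b\<close> the energy of the
  product is \<open>f(K, H)\<close> for the energies \<open>K\<close> and \<open>H\<close> of the factors, and the condition of vanishing
  mean Berwald curvature is carried along: from the chart \<open>c\<close> to pairs of coordinates, and from there to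
  the two factors.\<close>

lemma mean_berwald_product_iff:
  fixes c a b x y
  defines "z1 \<equiv> proj1 (tangent_lift (split_coords c a b) (x, y))"
    and "z2 \<equiv> proj2 (tangent_lift (split_coords c a b) (x, y))"
  assumes cab: "c \<in> A" "a \<in> A1" "b \<in> A2" and x: "x \<in> split_dom c a b"
    and nz: "snd z1 \<noteq> 0" "snd z2 \<noteq> 0"
  shows "(\<forall>i j. mean_berwald (energy A F c) i j (x, y) = 0) \<longleftrightarrow>
    (\<forall>i j. mean_berwald (energy A1 F1 a) i j z1 = 0) \<and> (\<forall>i j. mean_berwald (energy A2 F2 b) i j z2 = 0)"
proof -
  let ?W1 = "crange a \<times> (- {0})" and ?K = "energy A1 F1 a"
  let ?W2 = "crange b \<times> (- {0})" and ?H = "energy A2 F2 b"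
  let ?\<phi> = "split_coords c a b" and ?S = "split_dom c a b"
  interpret P: energy_product ?W1 ?K ?W2 ?H f
    using finsler_homogeneous_energy[OF M1 F1 cab(2)] finsler_homogeneous_energy[OF M2 F2 cab(3)] f
    by (simp add: energy_product_def energy_product_axioms_def)
  define W where "W = (?S \<times> UNIV) \<inter> tangent_lift ?\<phi> -` P.W"
  note S = open_split_dom[OF cab] and \<phi> = smooth_split_coords[OF cab]
  have "open W"
    unfolding W_def
    using continuous_open_preimage[OF smooth_on_continuous_on[OF smooth_on_tangent_lift[OF S \<phi>]] _ P.open_W] S
    by (simp add: open_Times)
  have G_eq: "energy A F c z = P.G (tangent_lift ?\<phi> z)" if "z \<in> W" for z
  proof -
    obtain x y where z: "z = (x, y)" "x \<in> ?S" using \<open>z \<in> W\<close> by (cases z) (auto simp: W_def)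
    have "0 \<le> f (?K (proj1 (tangent_lift ?\<phi> z)), ?H (proj2 (tangent_lift ?\<phi> z)))"
      using f by (simp add: product_function_def energy_def)
    then show ?thesis
      unfolding z(1) energy_def[of A] mink_product_def Let_def tmap_fst[OF cab z(2)] tmap_snd[OF cab z(2)]
        P.G_def P.energies_def
      by (simp add: energy_def)
  qed
  interpret C: coordinate_change ?S ?\<phi> W P.W "energy A F c" P.G
  proof
    show "bij (\<lambda>v. dird v ?\<phi> x)" if "x \<in> ?S" for x by (rule bij_split_coords[OF cab that])
  qed (use S \<phi> \<open>open W\<close> P.open_W P.smooth_G P.nondeg_G G_eq in \<open>auto simp: W_def\<close>)
  have zW: "(x, y) \<in> W"
    using x nz split_coords_crange[OF cab(1) x]
    by (simp add: W_def P.W_def z1_def z2_def tangent_lift_def)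
  have z12: "z1 \<in> ?W1" "z2 \<in> ?W2"
    using zW by (simp_all add: W_def P.W_def z1_def z2_def)
  have Q1: "smooth_on ?W1 (spray_vec ?K)"
    by (rule smooth_on_spray_vec[OF P.E1.open_W P.E1.smooth_K P.E1.nondeg_K])
  have Q2: "smooth_on ?W2 (spray_vec ?H)"
    by (rule smooth_on_spray_vec[OF P.E2.open_W P.E2.smooth_K P.E2.nondeg_K])
  have "geodesic_eq P.G z (P.Q (spray_vec ?K) (spray_vec ?H) z)" if "z \<in> P.W" for z
    unfolding P.Q_def[OF Q1 Q2]
    by (intro P.geodesic_eq_product that geodesic_eq_spray_vec[OF P.E1.open_W _ P.E1.smooth_K P.E1.nondeg_K]
      geodesic_eq_spray_vec[OF P.E2.open_W _ P.E2.smooth_K P.E2.nondeg_K] P.W_D[OF that])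
  note Q = this
  have "(\<forall>i j. mean_berwald (energy A F c) i j (x, y) = 0) \<longleftrightarrow>
      fibre_affine_at (vertical_div (spray_vec (energy A F c))) (x, y)"
    by (rule mean_berwald_zero_iff[OF C.open_W zW C.smooth_G C.nondeg])
  also have "\<dots> \<longleftrightarrow> fibre_affine_at (vertical_div (P.Q (spray_vec ?K) (spray_vec ?H))) (tangent_lift ?\<phi> (x, y))"
    by (rule C.fibre_affine_transform[OF smooth_on_spray_vec[OF C.open_W C.smooth_G C.nondeg]
      geodesic_eq_spray_vec[OF C.open_W _ C.smooth_G C.nondeg] P.smooth_Q[OF Q1 Q2] Q zW])
  also have "\<dots> \<longleftrightarrow> fibre_affine_at (vertical_div (spray_vec ?K)) z1 \<and> fibre_affine_at (vertical_div (spray_vec ?H)) z2"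
    using P.fibre_affine_product[OF Q1 Q2, of "tangent_lift ?\<phi> (x, y)"] zW
    by (simp add: W_def z1_def z2_def)
  also have "fibre_affine_at (vertical_div (spray_vec ?K)) z1 \<longleftrightarrow> (\<forall>i j. mean_berwald ?K i j z1 = 0)"
    by (rule mean_berwald_zero_iff[OF P.E1.open_W z12(1) P.E1.smooth_K P.E1.nondeg_K, symmetric])
  also have "fibre_affine_at (vertical_div (spray_vec ?H)) z2 \<longleftrightarrow> (\<forall>i j. mean_berwald ?H i j z2 = 0)"
    by (rule mean_berwald_zero_iff[OF P.E2.open_W z12(2) P.E2.smooth_K P.E2.nondeg_K, symmetric])
  finally show ?thesis .
qed

lemma product_weakly_berwald_if_factors:
  assumes wb: "weakly_berwald X1 A1 F1" "weakly_berwald X2 A2 F2"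
  shows "product_weakly_berwald f X1 A1 F1 X2 A2 F2"
  unfolding product_weakly_berwald_def weakly_berwald_on_def
proof (intro ballI allI impI)
  fix c x y i j
  assume c: "c \<in> A" and x: "x \<in> crange c" and reg: "tvec_of A c (x, y) \<in> regular_part X1 A1 X2 A2"
  have "cinv c x \<in> topspace X"
    using cinv_crange(1)[OF x] chart_onD(4)[OF chart[OF c]] by blast
  then obtain a b where ab: "a \<in> A1" "b \<in> A2" "cinv c x \<in> cdom (prod_chart a b)"
    using cover1 cover2 by (auto simp: mem_Times_iff)
  have xS: "x \<in> split_dom c a b"
    using ab(3) cinv_crange[OF x] by (intro image_eqI[of _ _ "cinv c x"]) auto
  let ?z = "tangent_lift (split_coords c a b) (x, y)"
  note cr = split_coords_crange[OF c xS]
  have z: "proj1 ?z = (fst (split_coords c a b x), snd (proj1 ?z))" "proj2 ?z = (snd (split_coords c a b x), snd (proj2 ?z))"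
    by (simp_all add: tangent_lift_def)
  have nz: "snd (proj1 ?z) \<noteq> 0" "snd (proj2 ?z) \<noteq> 0"
    using reg z tzero_tvec_of[OF A1 ab(1) cr(1)] tzero_tvec_of[OF A2 ab(2) cr(2)]
    unfolding regular_part_def Let_def mem_Collect_eq tmap_fst[OF c ab(1,2) xS] tmap_snd[OF c ab(1,2) xS]
    by metis+
  have "\<forall>i j. mean_berwald (energy A1 F1 a) i j (proj1 ?z) = 0"
    using wb(1) ab(1) cr(1) tvec_of_in_slit[OF A1 ab(1) cr(1) nz(1)] z(1)
    unfolding weakly_berwald_def weakly_berwald_on_def by metis
  moreover have "\<forall>i j. mean_berwald (energy A2 F2 b) i j (proj2 ?z) = 0"
    using wb(2) ab(2) cr(2) tvec_of_in_slit[OF A2 ab(2) cr(2) nz(2)] z(2)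
    unfolding weakly_berwald_def weakly_berwald_on_def by metis
  ultimately show "mean_berwald (energy A F c) i j (x, y) = 0"
    using mean_berwald_product_iff[OF c ab(1,2) xS nz] by blast
qed

text \<open>To recover the curvature of one factor, its tangent vector is completed by an arbitrary nonzero
  tangent vector of the other factor; in a product chart \<open>split_coords\<close> merely separates the
  components.\<close>

lemma factors_at_points:
  assumes wb: "product_weakly_berwald f X1 A1 F1 X2 A2 F2"
    and a: "a \<in> A1" "x1 \<in> crange a" "y1 \<noteq> 0" and b: "b \<in> A2" "x2 \<in> crange b" "y2 \<noteq> 0"
  shows "mean_berwald (energy A1 F1 a) i j (x1, y1) = 0" "mean_berwald (energy A2 F2 b) k l (x2, y2) = 0"
proof -
  let ?c = "prod_chart a b" and ?x = "vjoin x1 x2" and ?y = "vjoin y1 y2"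
  have c: "?c \<in> A" by (rule prod_chart_in[OF a(1) b(1)])
  have cr: "?x \<in> crange ?c" using a b by (simp add: crange_prod_chart)
  have dom: "split_dom ?c a b = crange ?c" by (simp add: crange_def)
  have xS: "?x \<in> split_dom ?c a b" unfolding dom by (rule cr)
  have sc: "split_coords ?c a b u = (vfst u, vsnd u)" if "u \<in> crange ?c" for u
    using that by (simp add: split_coords_def crange_prod_chart cinv_prod_chart[OF chart1[OF a(1)] chart2[OF b(1)]]
      cinv_crange)
  have "dird ?y (split_coords ?c a b) ?x = dird ?y (\<lambda>u. (vfst u, vsnd u)) ?x"
    using cr sc by (intro dird_cong_open[OF chart_onD(2)[OF chart[OF c]]]) auto
  also have "\<dots> = (y1, y2)"
    by (simp add: dird_bounded_linear bounded_linear_Pair bounded_linear_vfst bounded_linear_vsnd)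
  finally have z: "proj1 (tangent_lift (split_coords ?c a b) (?x, ?y)) = (x1, y1)"
    "proj2 (tangent_lift (split_coords ?c a b) (?x, ?y)) = (x2, y2)"
    by (simp_all add: tangent_lift_def sc[OF cr])
  have "tvec_of A ?c (?x, ?y) \<in> regular_part X1 A1 X2 A2"
    unfolding regular_part_def Let_def mem_Collect_eq tmap_fst[OF c a(1) b(1) xS] tmap_snd[OF c a(1) b(1) xS] z
    using tvec_of_in_tangent_bundle[OF A c cr] tzero_tvec_of[OF A1 a(1,2)] tzero_tvec_of[OF A2 b(1,2)] a(3) b(3)
    by blast
  then have "\<forall>i j. mean_berwald (energy A F ?c) i j (?x, ?y) = 0"
    using wb c cr unfolding product_weakly_berwald_def weakly_berwald_on_def by blast
  then show "mean_berwald (energy A1 F1 a) i j (x1, y1) = 0" "mean_berwald (energy A2 F2 b) k l (x2, y2) = 0"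
    using mean_berwald_product_iff[OF c a(1) b(1) xS, of ?y] a(3) b(3) unfolding z snd_conv by blast+
qed

lemma factors_weakly_berwald:
  assumes wb: "product_weakly_berwald f X1 A1 F1 X2 A2 F2"
  shows "weakly_berwald X1 A1 F1" "weakly_berwald X2 A2 F2"
proof -
  obtain p a where a: "a \<in> A1" "p \<in> cdom a"
    using M1 cover1 unfolding smooth_manifold_def by blast
  obtain q b where b: "b \<in> A2" "q \<in> cdom b"
    using M2 cover2 unfolding smooth_manifold_def by blast
  \<comment> \<open>A nonzero fibre coordinate vector for the factor that only serves as a companion.\<close>
  have one: "(1 :: real ^ 'k::finite) \<noteq> 0" by (simp add: vec_eq_iff)
  show "weakly_berwald X1 A1 F1"
    unfolding weakly_berwald_def weakly_berwald_on_def
  proof (intro ballI allI impI)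
    fix c x y i j
    assume c: "c \<in> A1" "x \<in> crange c" and "tvec_of A1 c (x, y) \<in> slit_tangent_bundle X1 A1"
    then have "y \<noteq> 0" by (simp add: slit_tangent_bundle_def tzero_tvec_of[OF A1 c])
    then show "mean_berwald (energy A1 F1 c) i j (x, y) = 0"
      by (rule factors_at_points(1)[OF wb c _ b(1) cmap_crange[OF b(2)] one])
  qed
  show "weakly_berwald X2 A2 F2"
    unfolding weakly_berwald_def weakly_berwald_on_def
  proof (intro ballI allI impI)
    fix c x y i j
    assume c: "c \<in> A2" "x \<in> crange c" and "tvec_of A2 c (x, y) \<in> slit_tangent_bundle X2 A2"
    then have "y \<noteq> 0" by (simp add: slit_tangent_bundle_def tzero_tvec_of[OF A2 c])
    then show "mean_berwald (energy A2 F2 c) i j (x, y) = 0"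
      by (rule factors_at_points(2)[OF wb a(1) cmap_crange[OF a(2)] one c])
  qed
qed

end

theorem theorem4p7:
  fixes X1 :: "'a topology" and A1 :: "('a, 'm::finite) chart set"
    and F1 :: "('a, 'm) tvec \<Rightarrow> real"
    and X2 :: "'b topology" and A2 :: "('b, 'n::finite) chart set"
    and F2 :: "('b, 'n) tvec \<Rightarrow> real"
    and f :: "real \<times> real \<Rightarrow> real"
  assumes "smooth_manifold X1 A1" and "finsler_metric X1 A1 F1"
    and "smooth_manifold X2 A2" and "finsler_metric X2 A2 F2"
    and "product_function f"
  shows "product_weakly_berwald f X1 A1 F1 X2 A2 F2 \<longleftrightarrow>
    weakly_berwald X1 A1 F1 \<and> weakly_berwald X2 A2 F2"
proof -
  interpret finsler_product X1 A1 F1 X2 A2 F2 f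
    using assms by (rule finsler_product.intro)
  show ?thesis
    using product_weakly_berwald_if_factors factors_weakly_berwald by blast
qed

end
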